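(* There exist absolute constants $C,c>0$ such that the following holds. Let $\mathcal I$ be a Max-2-CSP instance on $V=[n]$ with alphabet $[k]$ and regular constraint graph $G$, let $\epsilon>0$ and $r\ge C\,k\cdot\mathrm{rank}_{\ge c(\epsilon/k)^2}(G)/\epsilon^4$. Suppose the $r$-round Lasserre value of $\mathcal I$ is $\sigma$. Then, given an optimal $r$-round Lasserre solution, Propagation Sampling outputs an assignment whose expected value for $\mathcal I$ is at least $\sigma-\epsilon$.
   Context: A Max-2-CSP instance $\mathcal I$ is a probability distribution over triples $(i,j,\Pi)$, $i,j\in V$, $\Pi\subseteq[k]\times[k]$; the value of $x\in[k]^V$ is $\Pr_{(i,j,\Pi)\sim\mathcal I}[(x_i,x_j)\in\Pi]$. The constraint graph (weight of $\{i,j\}$ = probability mass of constraints on $i,j$) is regular and identified with its normalized adjacency matrix; $\mathrm{rank}_{\ge\tau}(G)$ is the number of its eigenvalues larger than $\tau$. An $r$-round Lasserre solution: consistent distributions $\mu_T$ on $[k]^T$ for all $T\subseteq V$, $|T|\le r+2$ (local random variables $X_1,\dots,X_n$), and vectors $v_{S,\alpha}$ ($|S|\le r+2$, $\alpha\in[k]^S$) with $\langle v_{S,\alpha},v_{T,\beta}\rangle=\Pr[X_S=\alpha,X_T=\beta]$ whenever $|S\cup T|\le r+2$; its value is $\mathbb E_{(i,j,\Pi)\sim\mathcal I}\Pr[(X_i,X_j)\in\Pi]$, and the Lasserre value is the maximum. Propagation Sampling: choose $m\in\{1,\dots,r\}$ uniformly; choose $S\in V^m$ uniformly (repetitions allowed);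 sample $x_S\sim\mu_S$; for every $i\in V\setminus S$ independently sample $x_i$ from $\mu_{S\cup\{i\}}$ conditioned on $X_S=x_S$; output $x$. *)

theory Defs
  imports "HOL-Probability.Probability" "Jordan_Normal_Form.Char_Poly"
begin

text \<open>
  Throughout, the vertex set \<open>V = [n]\<close> is \<open>{..<n}\<close>, the alphabet \<open>[k]\<close> is \<open>{..<k}\<close>, and
  \<open>[k]\<^sup>T\<close> is the set \<open>T \<rightarrow>\<^sub>E {..<k}\<close> of extensional functions. Sizes are plain natural numbers
  (not types), so that absolute constants can be quantified before them.
\<close>

type_synonym constraint = "nat \<times> nat \<times> (nat \<times> nat) set"

definition max_2csp :: "nat \<Rightarrow> nat \<Rightarrow> constraint pmf \<Rightarrow> bool" where
  "max_2csp n k I \<longleftrightarrow>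
     set_pmf I \<subseteq> {..<n} \<times> {..<n} \<times> Pow ({..<k} \<times> {..<k})"

definition csp_value :: "constraint pmf \<Rightarrow> (nat \<Rightarrow> nat) \<Rightarrow> real" where
  "csp_value I x = measure_pmf.prob I {(i, j, P). (x i, x j) \<in> P}"

definition edge_weight :: "constraint pmf \<Rightarrow> nat \<Rightarrow> nat \<Rightarrow> real" where
  "edge_weight I i j = measure_pmf.prob I {(a, b, P). {a, b} = {i, j}}"

text \<open>
  A constraint may have \<open>i = j\<close>. Such a loop has both of its endpoints at \<open>i\<close> and hence, as
  usual, counts twice in the adjacency matrix and in the degree. Thus the degree of \<open>i\<close> is
  twice the probability that a random endpoint of a random constraint is \<open>i\<close>.
\<close>

definition adjacency :: "constraint pmf \<Rightarrow> nat \<Rightarrow> nat \<Rightarrow> real" where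
  "adjacency I i j = (if i = j then 2 * edge_weight I i i else edge_weight I i j)"

definition weighted_degree :: "nat \<Rightarrow> constraint pmf \<Rightarrow> nat \<Rightarrow> real" where
  "weighted_degree n I i = (\<Sum>j<n. adjacency I i j)"

definition regular_constraint_graph :: "nat \<Rightarrow> constraint pmf \<Rightarrow> bool" where
  "regular_constraint_graph n I \<longleftrightarrow> (\<exists>d. \<forall>i<n. weighted_degree n I i = d)"

definition constraint_graph :: "nat \<Rightarrow> constraint pmf \<Rightarrow> real mat" where
  "constraint_graph n I = mat n n (\<lambda>(i, j). adjacency I i j / weighted_degree n I i)"

text \<open>The number of eigenvalues larger than \<open>\<tau>\<close>, counted with multiplicity.\<close>

definition threshold_rank :: "real \<Rightarrow> real mat \<Rightarrow> nat" where
  "threshold_rank \<tau> A = (\<Sum>a | eigenvalue A a \<and> a > \<tau>. order a (char_poly A))"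

definition consistent_local_distributions ::
  "nat \<Rightarrow> nat \<Rightarrow> nat \<Rightarrow> (nat set \<Rightarrow> (nat \<Rightarrow> nat) pmf) \<Rightarrow> bool" where
  "consistent_local_distributions n k r \<mu> \<longleftrightarrow>
     (\<forall>T \<subseteq> {..<n}. card T \<le> r + 2 \<longrightarrow>
        set_pmf (\<mu> T) \<subseteq> (T \<rightarrow>\<^sub>E {..<k}) \<and>
        (\<forall>S \<subseteq> T. map_pmf (\<lambda>x. restrict x S) (\<mu> T) = \<mu> S))"

text \<open>
  The vectors live in a Euclidean space of arbitrary finite dimension \<open>d\<close>, which is part of the
  choice of the solution.
\<close>

definition lasserre_solution ::
  "nat \<Rightarrow> nat \<Rightarrow> nat \<Rightarrow> (nat set \<Rightarrow> (nat \<Rightarrow> nat) pmf)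
     \<Rightarrow> (nat set \<Rightarrow> (nat \<Rightarrow> nat) \<Rightarrow> real vec) \<Rightarrow> bool" where
  "lasserre_solution n k r \<mu> v \<longleftrightarrow>
     consistent_local_distributions n k r \<mu> \<and>
     (\<exists>d. \<forall>S \<subseteq> {..<n}. card S \<le> r + 2 \<longrightarrow>
        (\<forall>\<alpha> \<in> S \<rightarrow>\<^sub>E {..<k}. v S \<alpha> \<in> carrier_vec d)) \<and>
     (\<forall>S \<subseteq> {..<n}. \<forall>T \<subseteq> {..<n}. card (S \<union> T) \<le> r + 2 \<longrightarrow>
        (\<forall>\<alpha> \<in> S \<rightarrow>\<^sub>E {..<k}. \<forall>\<beta> \<in> T \<rightarrow>\<^sub>E {..<k}.
           scalar_prod (v S \<alpha>) (v T \<beta>) =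
             measure_pmf.prob (\<mu> (S \<union> T)) {x. restrict x S = \<alpha> \<and> restrict x T = \<beta>}))"

definition solution_value ::
  "constraint pmf \<Rightarrow> (nat set \<Rightarrow> (nat \<Rightarrow> nat) pmf) \<Rightarrow> real" where
  "solution_value I \<mu> =
     measure_pmf.expectation I
       (\<lambda>(i, j, P). measure_pmf.prob (\<mu> {i, j}) {x. (x i, x j) \<in> P})"

text \<open>
  The supremum is a maximum whenever there is a solution, i.e. an optimal solution as defined
  below exists, by compactness of the set of Gram matrices of solutions.
\<close>

definition lasserre_value :: "nat \<Rightarrow> nat \<Rightarrow> nat \<Rightarrow> constraint pmf \<Rightarrow> real" where
  "lasserre_value n k r I = Sup {solution_value I \<mu> | \<mu> v. lasserre_solution n k r \<mu> v}"

definition optimal_lasserre_solution ::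
  "nat \<Rightarrow> nat \<Rightarrow> nat \<Rightarrow> constraint pmf \<Rightarrow> (nat set \<Rightarrow> (nat \<Rightarrow> nat) pmf)
     \<Rightarrow> (nat set \<Rightarrow> (nat \<Rightarrow> nat) \<Rightarrow> real vec) \<Rightarrow> bool" where
  "optimal_lasserre_solution n k r I \<mu> v \<longleftrightarrow>
     lasserre_solution n k r \<mu> v \<and>
     (\<forall>\<mu>' v'. lasserre_solution n k r \<mu>' v' \<longrightarrow> solution_value I \<mu>' \<le> solution_value I \<mu>)"

text \<open>
  A tuple in \<open>V\<^sup>m\<close> is a list \<open>s\<close> of length \<open>m\<close>, with underlying set \<open>S\<close>. For \<open>xS\<close> in the support
  of \<open>\<mu> S\<close> the conditioning event has positive probability by consistency.
\<close>

definition propagate ::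
  "nat \<Rightarrow> (nat set \<Rightarrow> (nat \<Rightarrow> nat) pmf) \<Rightarrow> nat set \<Rightarrow> (nat \<Rightarrow> nat) \<Rightarrow> (nat \<Rightarrow> nat) pmf" where
  "propagate n \<mu> S xS =
     map_pmf (\<lambda>y i. if i \<in> S then xS i else y i)
       (Pi_pmf ({..<n} - S) undefined
          (\<lambda>i. map_pmf (\<lambda>z. z i) (cond_pmf (\<mu> (insert i S)) {z. restrict z S = xS})))"

definition propagation_sampling ::
  "nat \<Rightarrow> nat \<Rightarrow> (nat set \<Rightarrow> (nat \<Rightarrow> nat) pmf) \<Rightarrow> (nat \<Rightarrow> nat) pmf" where
  "propagation_sampling n r \<mu> =
     bind_pmf (pmf_of_set {1..r}) (\<lambda>m.
     bind_pmf (pmf_of_set {s. set s \<subseteq> {..<n} \<and> length s = m}) (\<lambda>s.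
     bind_pmf (\<mu> (set s)) (\<lambda>xS.
     propagate n \<mu> (set s) xS)))"

end

theory Submission
  imports Defs "Jordan_Normal_Form.Schur_Decomposition"
begin

text \<open>
  Fix a seed set \<open>S\<close> and an outcome \<open>x\<close> for it, and condition the local distributions on it. On a
  constraint on \<open>i, j\<close>, rounding loses at most the distance \<open>\<Sum>\<bar>Cov(X\<^sub>i\<^sub>a, X\<^sub>j\<^sub>b)\<bar>\<close> between the joint law
  and the product law of \<open>X\<^sub>i, X\<^sub>j\<close>. By the inequality of the arithmetic and geometric means this is
  at most \<open>\<eta> + k / (4 \<eta>) M\<^sub>i\<^sub>j\<close>, where \<open>M\<^sub>i\<^sub>j = \<Sum> Cov(X\<^sub>i\<^sub>a, X\<^sub>j\<^sub>b)\<^sup>2 / \<surd>(p\<^sub>i\<^sub>a p\<^sub>j\<^sub>b)\<close> is a Gram matrix built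
  from tensor squares of the conditioned Lasserre vectors. Moreover \<open>M\<^sub>i\<^sub>j\<close> is at most the average of
  the drop of the variance of \<open>X\<^sub>i\<close> when \<open>X\<^sub>j\<close> is revealed and of the drop with \<open>i, j\<close> exchanged.

  Let \<open>m\<close> be the threshold rank and \<open>B\<close> the projection onto the eigenvectors of the normalized
  adjacency matrix \<open>A\<close> with eigenvalue above \<open>\<tau>\<close>, so that \<open>A \<le> \<tau> + B\<close>. As \<open>B\<close> has trace \<open>m\<close>, all but
  \<open>n / K\<close> vertices satisfy \<open>B\<^sub>i\<^sub>i \<le> K m / n\<close>. Discarding the exceptions costs \<open>4 / K\<close>, and on the
  remaining vertices \<open>\<langle>A, M\<rangle> \<le> \<tau> n + (K m / n) \<Sum> M\<^sub>i\<^sub>j\<close>: local correlation is bounded linearly by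
  global correlation. The latter is at most the expected decrease of the average variance caused by
  one more random seed. These decreases telescope over the number of seeds to at most 1, hence they
  average to at most \<open>1 / r\<close>. The theorem follows with \<open>K = 16 / \<epsilon>\<close>, \<open>\<eta> = \<epsilon> / 4\<close>,
  \<open>\<tau> = (\<epsilon> / k)\<^sup>2 / 4\<close>.
\<close>

section \<open>Real symmetric matrices\<close>

text \<open>As the matrix is real and symmetric, conjugation fixes the form \<open>Q\<close> of an
  eigenvector \<open>z\<close>. But \<open>Q\<close> is \<open>a\<close> times the squared norm
  \<open>N\<close> of \<open>z\<close>, a nonzero real number.\<close>

lemma symmetric_eigenvalue_real:
  fixes A :: "real mat"
  assumes A: "A \<in> carrier_mat n n" and sym: "transpose_mat A = A"
    and ev: "eigenvalue (map_mat complex_of_real A) a"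
  shows "a \<in> \<real>"
proof -
  let ?A = "map_mat complex_of_real A"
  obtain z where z: "z \<in> carrier_vec n" "z \<noteq> 0\<^sub>v n" "?A *\<^sub>v z = a \<cdot>\<^sub>v z"
    using ev A unfolding eigenvalue_def eigenvector_def by auto
  have Az: "(\<Sum>j<n. of_real (A $$ (i, j)) * z $ j) = a * z $ i" if "i < n" for i
    using arg_cong[OF z(3), of "\<lambda>v. v $ i"] that A z(1)
    by (simp add: scalar_prod_def atLeast0LessThan)
  have A_sym: "A $$ (i, j) = A $$ (j, i)" if "i < n" "j < n" for i j
    using that A arg_cong[OF sym, of "\<lambda>B. B $$ (i, j)"] by simp
  define N where "N = (\<Sum>i<n. z $ i * cnj (z $ i))"
  define Q where "Q = (\<Sum>i<n. \<Sum>j<n. of_real (A $$ (i, j)) * z $ j * cnj (z $ i))"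
  have Q: "Q = a * N"
    unfolding Q_def N_def sum_distrib_left
    by (intro sum.cong refl) (simp add: Az[symmetric] sum_distrib_right flip: mult.assoc)
  have "cnj Q = (\<Sum>i<n. \<Sum>j<n. of_real (A $$ (j, i)) * z $ i * cnj (z $ j))"
    unfolding Q_def by (auto intro!: sum.cong simp: A_sym mult_ac)
  also have "\<dots> = Q"
    unfolding Q_def by (rule sum.swap)
  finally have "cnj Q = Q" .
  have N: "N = of_real (\<Sum>i<n. (norm (z $ i))\<^sup>2)"
    unfolding N_def by (simp add: complex_norm_square del: of_real_power)
  have "N \<noteq> 0"
  proof
    assume "N = 0"
    hence "(\<Sum>i<n. (norm (z $ i))\<^sup>2) = 0" using N by (metis of_real_eq_0_iff)
    hence "\<forall>i<n. z $ i = 0" by (subst (asm) sum_nonneg_eq_0_iff) auto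
    thus False using z(1,2) by auto
  qed
  moreover have "cnj N = N" using N by simp
  ultimately have "cnj a = a" using \<open>cnj Q = Q\<close> Q by simp
  thus ?thesis by (simp add: Reals_cnj_iff)
qed

text \<open>Over the complex numbers the polynomial splits, and all roots are real by the previous
  lemma. The factorization is then pulled back along the injective embedding of polynomial
  rings.\<close>

lemma symmetric_char_poly_splits:
  fixes A :: "real mat"
  assumes A: "A \<in> carrier_mat n n" and sym: "transpose_mat A = A"
  obtains es where "char_poly A = (\<Prod>e\<leftarrow>es. [:- e, 1:])"
proof -
  interpret poly_hom: map_poly_inj_idom_hom complex_of_real ..
  let ?A = "map_mat complex_of_real A"
  have cA: "?A \<in> carrier_mat n n" using A by simp
  obtain as where as: "char_poly ?A = (\<Prod>a\<leftarrow>as. [:- a, 1:])"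
    using char_poly_factorized[OF cA] by auto
  have real: "a \<in> \<real>" if "a \<in> set as" for a
  proof (rule symmetric_eigenvalue_real[OF A sym])
    show "eigenvalue ?A a"
      unfolding eigenvalue_root_char_poly[OF cA] as poly_prod_list
      using that by (force simp: prod_list_zero_iff)
  qed
  have "map_poly complex_of_real (char_poly A) = char_poly ?A"
    by (rule of_real_hom.char_poly_hom[OF A, symmetric])
  also have "\<dots> = (\<Prod>a\<leftarrow>as. map_poly of_real [:- Re a, 1:])"
    unfolding as by (rule arg_cong[of _ _ prod_list], rule map_cong) (auto simp: real)
  also have "\<dots> = map_poly of_real (\<Prod>e\<leftarrow>map Re as. [:- e, 1:])"
    by (induction as) (simp_all only: list.map prod_list.Nil prod_list.Cons poly_hom.hom_mult poly_hom.hom_one)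
  finally have "char_poly A = (\<Prod>e\<leftarrow>map Re as. [:- e, 1:])"
    by (simp only: poly_hom.eq_iff)
  thus thesis by (rule that)
qed

text \<open>Deflation, by induction on the eigenvalues. In an orthonormal basis that starts with an
  eigenvector for \<open>e\<close>, the first column is \<open>e\<close> followed by zeros. By
  symmetry so is the first row, and a smaller symmetric block remains.\<close>

lemma symmetric_diagonalization:
  fixes A :: "real mat"
  assumes "A \<in> carrier_mat n n" "transpose_mat A = A" "char_poly A = (\<Prod>e\<leftarrow>es. [:- e, 1:])"
  shows "\<exists>U. similar_mat_wit A (mat_diag n ((!) es)) U (transpose_mat U)"
  using assms
proof (induction es arbitrary: A n)
  case Nil
  hence "n = 0" using degree_monic_char_poly[of A n] by simp
  thus ?case using Nil
    by (intro exI[of _ "1\<^sub>m 0"] similar_mat_witI[of _ _ 0]) (auto simp: mat_diag_def)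
next
  case (Cons e es)
  note A = Cons.prems(1) and sym = Cons.prems(2)
  let ?m = "n - 1"
  have cp: "char_poly A = [:- e, 1:] * (\<Prod>e\<leftarrow>es. [:- e, 1:])" using Cons.prems by simp
  have mon: "monic (\<Prod>e\<leftarrow>es. [:- e, 1:])" by (rule monic_prod_list) auto
  have "degree (char_poly A) = Suc (degree (\<Prod>e\<leftarrow>es. [:- e, 1:]))"
    unfolding cp using mon by (subst degree_mult_eq) auto
  hence n: "n \<noteq> 0" using degree_monic_char_poly[OF A] by auto
  have "eigenvalue A e" unfolding eigenvalue_root_char_poly[OF A] cp by simp
  then obtain v where v: "v \<in> carrier_vec n" "v \<noteq> 0\<^sub>v n" "A *\<^sub>v v = e \<cdot>\<^sub>v v"
    using A unfolding eigenvalue_def eigenvector_def by auto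
  interpret cof_vec_space n "TYPE(real)" .
  define b where "b = basis_completion v"
  define ws where "ws = gram_schmidt n b"
  note bc = basis_completion[OF v(1,2), folded b_def]
  have len_b: "length b = n" using bc by simp
  obtain vs where bv: "b = v # vs" using bc n by (cases b) auto
  note gs = gram_schmidt_result[OF bc(2,4,5) refl, folded ws_def]
  have ws: "set ws \<subseteq> carrier_vec n" "corthogonal ws" "length ws = n"
    using gs len_b by auto
  \<comment> \<open>Gram-Schmidt keeps the first vector, so the basis still begins with the
    eigenvector.\<close>
  have hd_ws: "hd ws = v" using gram_schmidt_hd[OF v(1), of vs, folded bv] unfolding ws_def .
  define nrm where "nrm w = sqrt (w \<bullet> w)" for w :: "real vec"
  define us where "us = map (\<lambda>w. (1 / nrm w) \<cdot>\<^sub>v w) ws"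
  have nth_ws: "ws ! i \<in> carrier_vec n" if "i < n" for i using ws that by auto
  have conj: "conjugate w = w" for w :: "real vec" by (intro eq_vecI) auto
  have ws_orth: "ws ! i \<bullet> ws ! j = 0 \<longleftrightarrow> i \<noteq> j" if "i < n" "j < n" for i j
    using corthogonalD[OF ws(2)] that ws(3) by (simp add: conj)
  have pos: "ws ! i \<bullet> ws ! i > 0" if "i < n" for i
  proof -
    have "ws ! i \<bullet> ws ! i \<ge> 0" unfolding scalar_prod_def by (auto intro: sum_nonneg)
    thus ?thesis using ws_orth[OF that that] by simp
  qed
  have us: "set us \<subseteq> carrier_vec n" "length us = n" using ws by (auto simp: us_def)
  have us_prod: "us ! i \<bullet> us ! j = (if i = j then 1 else 0)" if "i < n" "j < n" for i j
    using that ws(3) nth_ws[OF that(1)] nth_ws[OF that(2)] ws_orth[OF that] pos[OF that(1)]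
    by (auto simp: us_def nrm_def)
  have us_orth: "corthogonal us"
    by (rule corthogonalI) (use us(2) us_prod in \<open>auto simp: conj\<close>)
  define u where "u = (1 / nrm v) \<cdot>\<^sub>v v"
  have "ws ! 0 = v" using hd_ws ws(3) n by (cases ws) auto
  hence hd_us: "hd us = u" using n ws(3) by (cases ws) (auto simp: us_def u_def)
  have u: "u \<in> carrier_vec n" "u \<noteq> 0\<^sub>v n" "A *\<^sub>v u = e \<cdot>\<^sub>v u"
  proof -
    show u1: "u \<in> carrier_vec n" using v by (simp add: u_def)
    have "u = us ! 0" using hd_us us(2) n by (cases us) auto
    hence "u \<bullet> u = 1" using us_prod[of 0 0] n by simp
    thus "u \<noteq> 0\<^sub>v n" by auto
    show "A *\<^sub>v u = e \<cdot>\<^sub>v u"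
      unfolding u_def using v A by (simp add: mult_mat_vec smult_smult_assoc mult.commute)
  qed
  define W where "W = mat_of_cols n us"
  have W: "W \<in> carrier_mat n n" unfolding W_def using mat_of_cols_carrier(1)[of n us] us(2) by auto
  have TW: "transpose_mat W \<in> carrier_mat n n" using W by simp
  have col_W: "col W i = us ! i" if "i < n" for i
    using that us nth_mem[of i us] unfolding W_def by (metis col_mat_of_cols subsetD)
  have TW_W: "transpose_mat W * W = 1\<^sub>m n"
    by (rule eq_matI) (use W us_prod col_W in auto)
  have W_TW: "W * transpose_mat W = 1\<^sub>m n"
    using mat_mult_left_right_inverse[OF TW W TW_W] .
  \<comment> \<open>\<open>corthogonal_col_ev_0\<close> below speaks of
    \<open>corthogonal_inv\<close>, which rescales by squared lengths; for unit vectors over the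
    reals it is the transpose.\<close>
  have inv_W: "corthogonal_inv W = transpose_mat W"
  proof (rule eq_matI)
    fix i j assume ij: "i < dim_row (transpose_mat W)" "j < dim_col (transpose_mat W)"
    hence ij': "i < n" "j < n" using W by auto
    have "corthogonal_inv W $$ (i, j) = vec_inv (us ! i) $ j"
      using ij' W us nth_mem[of i us] col_W[OF ij'(1)]
      by (auto simp: corthogonal_inv_def mat_of_rows_def cols_def)
    also have "\<dots> = us ! i $ j"
      using us_prod[OF ij'(1) ij'(1)] by (simp add: vec_inv_def conj)
    also have "\<dots> = transpose_mat W $$ (i, j)"
      using ij' W us col_W[OF ij'(1)] by (metis col_def index_transpose_mat(1) index_vec carrier_matD)
    finally show "corthogonal_inv W $$ (i, j) = transpose_mat W $$ (i, j)" .
  qed (use W in \<open>auto simp: corthogonal_inv_def mat_of_rows_def\<close>)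
  define A' where "A' = transpose_mat W * A * W"
  have A': "A' \<in> carrier_mat n n" using W TW A by (simp add: A'_def)
  have simA: "similar_mat_wit A A' W (transpose_mat W)"
  proof (rule similar_mat_witI[of _ _ n])
    have "W * A' * transpose_mat W = (W * transpose_mat W) * A * (W * transpose_mat W)"
      unfolding A'_def using W TW A by (simp add: assoc_mult_mat[of _ n n _ n _ n])
    thus "A = W * A' * transpose_mat W" using W_TW A by simp
  qed (use W TW A A' W_TW TW_W in auto)
  have A'_sym: "transpose_mat A' = A'"
    unfolding A'_def using W TW A sym
    by (simp add: transpose_mult[of _ n n _ n] assoc_mult_mat[of _ n n _ n _ n])
  have col0: "col A' 0 = vec n (\<lambda>i. if i = 0 then e else 0)"
    using corthogonal_col_ev_0[OF A u n hd_us us(1) us_orth us(2)]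
    by (simp add: A'_def inv_W flip: W_def)
  have A'_c0: "A' $$ (i, 0) = (if i = 0 then e else 0)" if "i < n" for i
    using arg_cong[OF col0, of "\<lambda>w. w $ i"] that A' n by (simp add: col_def)
  have A'_s: "A' $$ (i, j) = A' $$ (j, i)" if "i < n" "j < n" for i j
    using that A' arg_cong[OF A'_sym, of "\<lambda>B. B $$ (i, j)"] by simp
  define A3 where "A3 = mat ?m ?m (\<lambda>(i, j). A' $$ (Suc i, Suc j))"
  define E where "E = mat 1 1 (\<lambda>_. e)"
  have A3: "A3 \<in> carrier_mat ?m ?m" and E: "E \<in> carrier_mat 1 1"
    by (auto simp: A3_def E_def)
  have A3_sym: "transpose_mat A3 = A3"
    by (rule eq_matI) (auto simp: A3_def intro: A'_s)
  have block: "A' = four_block_mat E (0\<^sub>m 1 ?m) (0\<^sub>m ?m 1) A3"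
    by (rule eq_matI) (use A' A'_c0 A'_s n A'_s[of 0] in \<open>auto simp: E_def A3_def\<close>)
  \<comment> \<open>Similarity preserves the characteristic polynomial, and the block form factors
    it. Cancelling the factor of \<open>e\<close> leaves the hypothesis of the induction for
    \<open>A3\<close>.\<close>
  have "[:- e, 1:] * (\<Prod>e\<leftarrow>es. [:- e, 1:]) = char_poly A'"
    using char_poly_similar[of A A'] simA cp unfolding similar_mat_def by metis
  also have "\<dots> = char_poly E * char_poly A3"
    unfolding block by (rule char_poly_four_block_zeros_col[OF E _ A3]) simp
  also have "char_poly E = [:- e, 1:]"
    by (simp add: E_def char_poly_defs det_def sign_def)
  finally have "char_poly A3 = (\<Prod>e\<leftarrow>es. [:- e, 1:])"
    by (metis mult_cancel_left pCons_eq_0_iff zero_neq_one)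
  from Cons.IH[OF A3 A3_sym this] obtain U
    where U: "similar_mat_wit A3 (mat_diag ?m ((!) es)) U (transpose_mat U)" by blast
  have U': "U \<in> carrier_mat ?m ?m" using similar_mat_witD2[OF A3 U] by auto
  let ?U = "four_block_mat (1\<^sub>m 1) (0\<^sub>m 1 ?m) (0\<^sub>m ?m 1) U"
  have D: "mat_diag n ((!) (e # es)) = four_block_mat E (0\<^sub>m 1 ?m) (0\<^sub>m ?m 1) (mat_diag ?m ((!) es))"
    by (rule eq_matI) (use n in \<open>auto simp: mat_diag_def E_def nth_Cons'\<close>)
  have "similar_mat_wit A' (mat_diag n ((!) (e # es))) ?U
      (four_block_mat (1\<^sub>m 1) (0\<^sub>m 1 ?m) (0\<^sub>m ?m 1) (transpose_mat U))"
    unfolding block D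
    by (rule similar_mat_wit_four_block[OF similar_mat_wit_refl[OF E] U _ _ E A3])
      (use U' in auto)
  also have "four_block_mat (1\<^sub>m 1) (0\<^sub>m 1 ?m) (0\<^sub>m ?m 1) (transpose_mat U) = transpose_mat ?U"
    using U' by (subst transpose_four_block_mat[of _ 1 1 _ ?m _ ?m]) auto
  finally have sim': "similar_mat_wit A' (mat_diag n ((!) (e # es))) ?U (transpose_mat ?U)" .
  have cU: "?U \<in> carrier_mat n n" using U' n by (metis Suc_diff_1 four_block_carrier_mat neq0_conv one_carrier_mat plus_1_eq_Suc)
  have "transpose_mat (W * ?U) = transpose_mat ?U * transpose_mat W"
    by (rule transpose_mult[OF W cU])
  thus ?case using similar_mat_wit_trans[OF simA sim'] by metis
qed

text \<open>Turns the algebraic multiplicities in \<open>threshold_rank\<close> into repetitions in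
  the list of eigenvalues.\<close>

lemma order_prod_linear_factors:
  fixes es :: "real list"
  shows "Polynomial.order a (\<Prod>e\<leftarrow>es. [:- e, 1:]) = count_list es a"
proof (induction es)
  case (Cons e es)
  have "(\<Prod>e\<leftarrow>es. [:- e, 1:]) \<noteq> 0" for es :: "real list"
    by (auto simp: prod_list_zero_iff)
  moreover have "Polynomial.order a [:- e, 1:] = (if e = a then 1 else 0)"
    using order_power_n_n[of a 1] by (auto intro: order_0I)
  ultimately show ?case
    using Cons.IH by (simp add: order_mult[of "[:- e, 1:]"] del: mult_pCons_left)
qed (simp add: order_0I)

text \<open>\<open>f s\<close> is the eigenvector for \<open>l s\<close>. Orthonormality is recorded
  for traces of spectral projections, completeness for writing squared norms in the
  eigenbasis.\<close>

definition spectral_decomposition ::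
  "nat \<Rightarrow> (nat \<Rightarrow> nat \<Rightarrow> real) \<Rightarrow> (nat \<Rightarrow> real) \<Rightarrow> (nat \<Rightarrow> nat \<Rightarrow> real) \<Rightarrow> bool" where
  "spectral_decomposition n a l f \<longleftrightarrow>
     (\<forall>i<n. \<forall>j<n. a i j = (\<Sum>s<n. l s * (f s i * f s j))) \<and>
     (\<forall>s<n. \<forall>t<n. (\<Sum>i<n. f s i * f t i) = (if s = t then 1 else 0)) \<and>
     (\<forall>i<n. \<forall>j<n. (\<Sum>s<n. f s i * f s j) = (if i = j then 1 else 0))"

lemma spectral_decompositionD:
  assumes "spectral_decomposition n a l f"
  shows "i < n \<Longrightarrow> j < n \<Longrightarrow> a i j = (\<Sum>s<n. l s * (f s i * f s j))"
    and "s < n \<Longrightarrow> t < n \<Longrightarrow> (\<Sum>i<n. f s i * f t i) = (if s = t then 1 else 0)"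
    and "i < n \<Longrightarrow> j < n \<Longrightarrow> (\<Sum>s<n. f s i * f s j) = (if i = j then 1 else 0)"
  using assms unfolding spectral_decomposition_def by blast+

lemma symmetric_spectral_decomposition:
  fixes A :: "real mat"
  assumes A: "A \<in> carrier_mat n n" and sym: "transpose_mat A = A"
  obtains l f where "spectral_decomposition n (\<lambda>i j. A $$ (i, j)) l f"
    and "\<forall>\<tau>. threshold_rank \<tau> A = card {s. s < n \<and> \<tau> < l s}"
proof -
  obtain es where es: "char_poly A = (\<Prod>e\<leftarrow>es. [:- e, 1:])"
    using symmetric_char_poly_splits[OF A sym] .
  obtain U where U: "similar_mat_wit A (mat_diag n ((!) es)) U (transpose_mat U)"
    using symmetric_diagonalization[OF A sym es] by blast
  note D = similar_mat_witD2[OF A U]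
  have U_c: "U \<in> carrier_mat n n" using D by simp
  have "length es = n"
    using degree_linear_factors[of uminus es] degree_monic_char_poly[OF A] es by simp
  \<comment> \<open>The eigenvectors are the columns of \<open>U\<close>. Its two products with its
    transpose give orthonormality and completeness.\<close>
  show thesis
  proof (rule that[of "(!) es" "\<lambda>s i. U $$ (i, s)"], unfold spectral_decomposition_def, intro conjI allI impI)
    fix i j assume ij: "i < n" "j < n"
    have "U * mat_diag n ((!) es) = mat n n (\<lambda>(i, j). U $$ (i, j) * es ! j)"
      using mat_diag_mult_right[OF U_c] by (simp add: mult.commute)
    hence "A = mat n n (\<lambda>(i, j). U $$ (i, j) * es ! j) * transpose_mat U" using D(3) by simp
    hence "A $$ (i, j) = (mat n n (\<lambda>(i, j). U $$ (i, j) * es ! j) * transpose_mat U) $$ (i, j)"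
      by simp
    also have "\<dots> = (\<Sum>s<n. es ! s * (U $$ (i, s) * U $$ (j, s)))"
      using ij U_c by (auto simp: scalar_prod_def atLeast0LessThan intro!: sum.cong)
    finally show "A $$ (i, j) = (\<Sum>s<n. es ! s * (U $$ (i, s) * U $$ (j, s)))" .
  next
    fix i j assume ij: "i < n" "j < n"
    show "(\<Sum>s<n. U $$ (s, i) * U $$ (s, j)) = (if i = j then 1 else 0)"
      using arg_cong[OF D(2), of "\<lambda>B. B $$ (i, j)"] ij U_c
      by (simp add: scalar_prod_def atLeast0LessThan)
  next
    fix i j assume ij: "i < n" "j < n"
    show "(\<Sum>s<n. U $$ (i, s) * U $$ (j, s)) = (if i = j then 1 else 0)"
      using arg_cong[OF D(1), of "\<lambda>B. B $$ (i, j)"] ij U_c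
      by (simp add: scalar_prod_def atLeast0LessThan)
  next
    show "\<forall>\<tau>. threshold_rank \<tau> A = card {s. s < n \<and> \<tau> < es ! s}"
    proof
      fix \<tau>
      let ?fs = "filter (\<lambda>a. a > \<tau>) es"
      have ev: "eigenvalue A a \<longleftrightarrow> a \<in> set es" for a
        unfolding eigenvalue_root_char_poly[OF A] es poly_prod_list
        by (force simp: prod_list_zero_iff)
      have "threshold_rank \<tau> A = (\<Sum>a\<in>set ?fs. count_list es a)"
        unfolding threshold_rank_def es order_prod_linear_factors by (simp add: ev)
      also have "\<dots> = (\<Sum>a\<in>set ?fs. count_list ?fs a)"
        by (rule sum.cong) (auto simp: count_list_eq_length_filter conj_commute intro!: arg_cong[of _ _ length] filter_cong)
      also have "\<dots> = length ?fs" by (rule sum_count_set) auto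
      also have "\<dots> = card {s. s < n \<and> es ! s > \<tau>}"
        unfolding length_filter_conv_card \<open>length es = n\<close> ..
      finally show "threshold_rank \<tau> A = card {s. s < n \<and> es ! s > \<tau>}" .
    qed
  qed
qed

section \<open>Local and global correlation\<close>

text \<open>\<open>l s\<close> is the quadratic form of \<open>a\<close> at the unit vector
  \<open>f s\<close>. Bound each product of coordinates by the mean of their squares; the row and
  column sums then give 1.\<close>

lemma stochastic_eigenvalue_le_1:
  fixes a :: "nat \<Rightarrow> nat \<Rightarrow> real"
  assumes nonneg: "\<And>i j. i < n \<Longrightarrow> j < n \<Longrightarrow> 0 \<le> a i j"
    and row: "\<And>i. i < n \<Longrightarrow> (\<Sum>j<n. a i j) = 1"
    and col: "\<And>j. j < n \<Longrightarrow> (\<Sum>i<n. a i j) = 1"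
    and dec: "spectral_decomposition n a l f"
    and s: "s < n"
  shows "l s \<le> 1"
proof -
  note spec = spectral_decompositionD(1)[OF dec] and orth = spectral_decompositionD(2)[OF dec]
  have "(\<Sum>i<n. \<Sum>j<n. a i j * (f s i * f s j))
      = (\<Sum>i<n. \<Sum>j<n. \<Sum>t<n. l t * ((f t i * f s i) * (f t j * f s j)))"
    by (intro sum.cong refl) (simp add: spec sum_distrib_left sum_distrib_right mult_ac)
  also have "\<dots> = (\<Sum>i<n. \<Sum>t<n. \<Sum>j<n. l t * ((f t i * f s i) * (f t j * f s j)))"
    by (rule sum.cong[OF refl], rule sum.swap)
  also have "\<dots> = (\<Sum>t<n. \<Sum>i<n. \<Sum>j<n. l t * ((f t i * f s i) * (f t j * f s j)))"
    by (rule sum.swap)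
  also have "\<dots> = (\<Sum>t<n. l t * ((\<Sum>i<n. f t i * f s i) * (\<Sum>j<n. f t j * f s j)))"
    unfolding sum_product by (simp add: sum_distrib_left)
  also have "\<dots> = (\<Sum>t<n. if t = s then l t else 0)"
    by (intro sum.cong refl) (use s in \<open>simp add: orth\<close>)
  also have "\<dots> = l s" using s by simp
  finally have "l s = (\<Sum>i<n. \<Sum>j<n. a i j * (f s i * f s j))" ..
  also have "\<dots> \<le> (\<Sum>i<n. \<Sum>j<n. a i j * ((f s i * f s i + f s j * f s j) / 2))"
  proof (intro sum_mono mult_left_mono)
    fix i j
    show "f s i * f s j \<le> (f s i * f s i + f s j * f s j) / 2"
      using sum_squares_bound[of "f s i" "f s j"] by (simp add: power2_eq_square)
  qed (auto intro: nonneg)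
  also have "\<dots> = ((\<Sum>i<n. \<Sum>j<n. a i j * (f s i * f s i)) + (\<Sum>i<n. \<Sum>j<n. a i j * (f s j * f s j))) / 2"
  proof -
    have "x * ((y + z) / 2) = (x * y) / 2 + (x * z) / 2" for x y z :: real
      by (simp add: field_simps)
    thus ?thesis by (simp only: sum.distrib sum_divide_distrib add_divide_distrib)
  qed
  also have "(\<Sum>i<n. \<Sum>j<n. a i j * (f s i * f s i)) = (\<Sum>i<n. f s i * f s i)"
    by (simp add: sum_distrib_right[symmetric] row)
  also have "\<dots> = 1" using orth[OF s s] by simp
  also have "(\<Sum>i<n. \<Sum>j<n. a i j * (f s j * f s j)) = (\<Sum>j<n. \<Sum>i<n. a i j * (f s j * f s j))"
    by (rule sum.swap)
  also have "\<dots> = (\<Sum>j<n. f s j * f s j)"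
    by (simp add: sum_distrib_right[symmetric] col)
  also have "\<dots> = 1" using orth[OF s s] by simp
  finally show ?thesis by simp
qed

text \<open>The inequality A <= \<tau> + B of quadratic forms. In the eigenbasis it says that
  \<open>l s\<close> is at most \<tau>, or at most \<tau> + 1 when it exceeds \<tau>. Only upper
  bounds enter, so very negative eigenvalues are harmless.\<close>

lemma quadratic_form_le_threshold:
  fixes a :: "nat \<Rightarrow> nat \<Rightarrow> real" and w :: "nat \<Rightarrow> real"
  assumes dec: "spectral_decomposition n a l f"
    and le1: "\<And>s. s < n \<Longrightarrow> l s \<le> 1" and \<tau>: "0 \<le> \<tau>"
  shows "(\<Sum>i<n. \<Sum>j<n. a i j * (w i * w j))
    \<le> \<tau> * (\<Sum>i<n. w i * w i) + (\<Sum>i<n. \<Sum>j<n. (\<Sum>s | s < n \<and> \<tau> < l s. f s i * f s j) * (w i * w j))"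
proof -
  note spec = spectral_decompositionD(1)[OF dec] and compl = spectral_decompositionD(3)[OF dec]
  define g where "g s = (\<Sum>i<n. f s i * w i)" for s
  have quad: "(\<Sum>i<n. \<Sum>j<n. (\<Sum>s\<in>S. c s * (f s i * f s j)) * (w i * w j)) = (\<Sum>s\<in>S. c s * (g s * g s))"
    for S c
  proof -
    have "(\<Sum>i<n. \<Sum>j<n. (\<Sum>s\<in>S. c s * (f s i * f s j)) * (w i * w j))
        = (\<Sum>i<n. \<Sum>j<n. \<Sum>s\<in>S. c s * ((f s i * w i) * (f s j * w j)))"
      by (simp add: sum_distrib_left sum_distrib_right mult_ac)
    also have "\<dots> = (\<Sum>i<n. \<Sum>s\<in>S. \<Sum>j<n. c s * ((f s i * w i) * (f s j * w j)))"
      by (rule sum.cong[OF refl], rule sum.swap)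
    also have "\<dots> = (\<Sum>s\<in>S. \<Sum>i<n. \<Sum>j<n. c s * ((f s i * w i) * (f s j * w j)))"
      by (rule sum.swap)
    also have "\<dots> = (\<Sum>s\<in>S. c s * (g s * g s))"
      unfolding g_def sum_product by (simp add: sum_distrib_left)
    finally show ?thesis .
  qed
  have "(\<Sum>i<n. \<Sum>j<n. a i j * (w i * w j)) = (\<Sum>s<n. l s * (g s * g s))"
    unfolding quad[symmetric] by (intro sum.cong refl) (simp add: spec)
  also have "\<dots> \<le> (\<Sum>s<n. \<tau> * (g s * g s) + (if \<tau> < l s then g s * g s else 0))"
  proof (rule sum_mono)
    fix s assume s: "s \<in> {..<n}"
    show "l s * (g s * g s) \<le> \<tau> * (g s * g s) + (if \<tau> < l s then g s * g s else 0)"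
    proof (cases "\<tau> < l s")
      case True
      have "l s * (g s * g s) \<le> (\<tau> + 1) * (g s * g s)"
        by (rule mult_right_mono) (use le1[of s] s \<tau> in auto)
      thus ?thesis using True by (simp add: algebra_simps)
    qed (auto intro: mult_right_mono)
  qed
  also have "\<dots> = (\<Sum>s<n. \<tau> * (g s * g s)) + (\<Sum>s | s < n \<and> \<tau> < l s. 1 * (g s * g s))"
    by (simp add: sum.distrib sum.If_cases Int_def lessThan_def)
  also have "(\<Sum>s<n. \<tau> * (g s * g s)) = \<tau> * (\<Sum>s<n. 1 * (g s * g s))"
    by (simp add: sum_distrib_left)
  also have "(\<Sum>s<n. 1 * (g s * g s)) = (\<Sum>i<n. w i * w i)"
  proof -
    have "(\<Sum>s<n. 1 * (g s * g s)) = (\<Sum>i<n. \<Sum>j<n. (\<Sum>s<n. 1 * (f s i * f s j)) * (w i * w j))"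
      by (rule quad[symmetric])
    also have "\<dots> = (\<Sum>i<n. \<Sum>j<n. if i = j then w i * w j else 0)"
      by (intro sum.cong refl) (simp add: compl)
    also have "\<dots> = (\<Sum>i<n. w i * w i)" by simp
    finally show ?thesis .
  qed
  also have "(\<Sum>s | s < n \<and> \<tau> < l s. 1 * (g s * g s))
      = (\<Sum>i<n. \<Sum>j<n. (\<Sum>s | s < n \<and> \<tau> < l s. f s i * f s j) * (w i * w j))"
    unfolding quad[symmetric] by simp
  finally show ?thesis .
qed

text \<open>A Gram matrix is a sum of rank-one forms, to each of which the preceding inequality
  applies. Afterwards the projection \<open>B\<close> is bounded entry by entry off
  \<open>X\<close>; this is where the entries of \<open>M\<close> have to be nonnegative.\<close>

lemma local_correlation_le_global:
  fixes a M :: "nat \<Rightarrow> nat \<Rightarrow> real" and w :: "'t \<Rightarrow> nat \<Rightarrow> real"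
  assumes dec: "spectral_decomposition n a l f"
    and le1: "\<And>s. s < n \<Longrightarrow> l s \<le> 1" and \<tau>: "0 \<le> \<tau>"
    and m: "m = card {s. s < n \<and> \<tau> < l s}"
    and gram: "\<And>i j. i < n \<Longrightarrow> j < n \<Longrightarrow> M i j = (\<Sum>t\<in>T. w t i * w t j)"
    and M_nonneg: "\<And>i j. i < n \<Longrightarrow> j < n \<Longrightarrow> 0 \<le> M i j"
    and M_diag: "\<And>i. i < n \<Longrightarrow> M i i \<le> 1"
    and K: "0 < K" and n: "0 < n"
  obtains X where "X \<subseteq> {..<n}" "real (card X) \<le> n / K"
    and "(\<Sum>i<n. \<Sum>j<n. a i j * (if i \<in> X \<or> j \<in> X then 0 else M i j))
      \<le> \<tau> * n + K * m / n * (\<Sum>i<n. \<Sum>j<n. M i j)"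
proof -
  note orth = spectral_decompositionD(2)[OF dec]
  define L where "L = {s. s < n \<and> \<tau> < l s}"
  define B where "B i j = (\<Sum>s\<in>L. f s i * f s j)" for i j
  \<comment> \<open>the vertices of high leverage\<close>
  define X where "X = {i. i < n \<and> K * m / n < B i i}"
  have fin: "finite L" by (simp add: L_def)
  have B_diag: "0 \<le> B i i" for i unfolding B_def by (intro sum_nonneg) auto
  \<comment> \<open>\<open>B\<close> is positive semidefinite, so its diagonal controls all
    entries.\<close>
  have B_le: "B i j \<le> (B i i + B j j) / 2" for i j
  proof -
    have "B i j \<le> (\<Sum>s\<in>L. (f s i * f s i + f s j * f s j) / 2)"
      unfolding B_def
    proof (rule sum_mono)
      fix s show "f s i * f s j \<le> (f s i * f s i + f s j * f s j) / 2"
        using sum_squares_bound[of "f s i" "f s j"] by (simp add: power2_eq_square)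
    qed
    thus ?thesis by (simp add: B_def sum.distrib sum_divide_distrib[symmetric])
  qed
  have trace: "(\<Sum>i<n. B i i) = m"
  proof -
    have "(\<Sum>i<n. B i i) = (\<Sum>s\<in>L. \<Sum>i<n. f s i * f s i)" unfolding B_def by (rule sum.swap)
    also have "\<dots> = (\<Sum>s\<in>L. 1)" by (intro sum.cong refl) (simp add: orth L_def)
    finally show ?thesis by (simp add: m L_def)
  qed
  have X_sub: "X \<subseteq> {..<n}" by (auto simp: X_def)
  \<comment> \<open>Markov's inequality for the leverages \<open>B i i\<close>, which sum to
    \<open>m\<close>. For \<open>m = 0\<close> the threshold is 0 and the division breaks down, but
    then \<open>B\<close> vanishes and \<open>X\<close> is empty.\<close>
  have card_X: "real (card X) \<le> n / K"
  proof (cases "m = 0")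
    case True
    hence "L = {}" using fin m by (simp add: L_def)
    hence "X = {}" by (auto simp: X_def B_def True)
    thus ?thesis using K by simp
  next
    case False
    have "real (card X) * (K * m / n) = (\<Sum>i\<in>X. K * m / n)" by simp
    also have "\<dots> \<le> (\<Sum>i\<in>X. B i i)" by (intro sum_mono) (auto simp: X_def)
    also have "\<dots> \<le> (\<Sum>i<n. B i i)" by (rule sum_mono2) (use X_sub B_diag in auto)
    finally have "real (card X) * (K * m / n) \<le> m" using trace by simp
    thus ?thesis using False K n by (simp add: field_simps)
  qed
  \<comment> \<open>Masking the vertices of \<open>X\<close> in the factors masks their rows and
    columns in \<open>M\<close> and keeps the Gram form.\<close>
  let ?v = "\<lambda>t i. if i \<in> X then 0 else w t i"
  let ?M = "\<lambda>i j. if i \<in> X \<or> j \<in> X then 0 else M i j"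
  have M_v: "?M i j = (\<Sum>t\<in>T. ?v t i * ?v t j)" if "i < n" "j < n" for i j
    using gram[OF that] by auto
  have swap: "(\<Sum>i<n. \<Sum>j<n. c i j * ?M i j) = (\<Sum>t\<in>T. \<Sum>i<n. \<Sum>j<n. c i j * (?v t i * ?v t j))" for c
  proof -
    have "(\<Sum>i<n. \<Sum>j<n. c i j * ?M i j) = (\<Sum>i<n. \<Sum>j<n. \<Sum>t\<in>T. c i j * (?v t i * ?v t j))"
      by (intro sum.cong refl, subst M_v) (auto simp: sum_distrib_left)
    also have "\<dots> = (\<Sum>i<n. \<Sum>t\<in>T. \<Sum>j<n. c i j * (?v t i * ?v t j))"
      by (rule sum.cong[OF refl], rule sum.swap)
    also have "\<dots> = (\<Sum>t\<in>T. \<Sum>i<n. \<Sum>j<n. c i j * (?v t i * ?v t j))" by (rule sum.swap)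
    finally show ?thesis .
  qed
  have "(\<Sum>i<n. \<Sum>j<n. a i j * ?M i j) = (\<Sum>t\<in>T. \<Sum>i<n. \<Sum>j<n. a i j * (?v t i * ?v t j))"
    by (rule swap)
  also have "\<dots> \<le> (\<Sum>t\<in>T. \<tau> * (\<Sum>i<n. ?v t i * ?v t i) + (\<Sum>i<n. \<Sum>j<n. B i j * (?v t i * ?v t j)))"
    unfolding B_def L_def by (intro sum_mono quadratic_form_le_threshold dec le1 \<tau>)
  also have "\<dots> = \<tau> * (\<Sum>t\<in>T. \<Sum>i<n. ?v t i * ?v t i) + (\<Sum>i<n. \<Sum>j<n. B i j * ?M i j)"
    unfolding swap by (simp only: sum.distrib sum_distrib_left)
  also have "(\<Sum>t\<in>T. \<Sum>i<n. ?v t i * ?v t i) = (\<Sum>i<n. \<Sum>t\<in>T. ?v t i * ?v t i)" by (rule sum.swap)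
  also have "\<dots> = (\<Sum>i<n. ?M i i)" by (intro sum.cong refl) (simp only: M_v lessThan_iff)
  also have "\<tau> * (\<Sum>i<n. ?M i i) \<le> \<tau> * (\<Sum>i<n. 1)"
    by (intro mult_left_mono sum_mono \<tau>) (use M_diag in auto)
  also have "(\<Sum>i<n. \<Sum>j<n. B i j * ?M i j) \<le> (\<Sum>i<n. \<Sum>j<n. (K * m / n) * M i j)"
  proof (intro sum_mono)
    fix i j assume "i \<in> {..<n}" "j \<in> {..<n}"
    hence ij: "i < n" "j < n" by auto
    show "B i j * ?M i j \<le> (K * m / n) * M i j"
    proof (cases "i \<in> X \<or> j \<in> X")
      case True
      thus ?thesis using M_nonneg[OF ij] K by simp
    next
      case False
      hence "B i i \<le> K * m / n" "B j j \<le> K * m / n" using ij by (auto simp: X_def)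
      hence "B i j \<le> K * m / n" using B_le[of i j] by simp
      from mult_right_mono[OF this M_nonneg[OF ij]] show ?thesis using False by simp
    qed
  qed
  also have "\<dots> = K * m / n * (\<Sum>i<n. \<Sum>j<n. M i j)" by (simp only: sum_distrib_left)
  finally have "(\<Sum>i<n. \<Sum>j<n. a i j * ?M i j) \<le> \<tau> * n + K * m / n * (\<Sum>i<n. \<Sum>j<n. M i j)"
    by simp
  thus thesis using X_sub card_X by (intro that)
qed

section \<open>Covariances of pairwise distributions\<close>

text \<open>\<open>p i a\<close> stands for Pr[X_i = a] and \<open>J i a j b\<close> for
  Pr[X_i = a, X_j = b]: this is the covariance of two indicators.\<close>

definition cov :: "(nat \<Rightarrow> nat \<Rightarrow> real) \<Rightarrow> (nat \<Rightarrow> nat \<Rightarrow> nat \<Rightarrow> nat \<Rightarrow> real)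
    \<Rightarrow> nat \<Rightarrow> nat \<Rightarrow> nat \<Rightarrow> nat \<Rightarrow> real" where
  "cov p J i a j b = J i a j b - p i a * p j b"

text \<open>The l1 distance between the joint law of X_i, X_j and the product of the
  marginals.\<close>

definition pair_dist :: "nat \<Rightarrow> (nat \<Rightarrow> nat \<Rightarrow> real) \<Rightarrow> (nat \<Rightarrow> nat \<Rightarrow> nat \<Rightarrow> nat \<Rightarrow> real)
    \<Rightarrow> nat \<Rightarrow> nat \<Rightarrow> real" where
  "pair_dist k p J i j = (\<Sum>a<k. \<Sum>b<k. \<bar>cov p J i a j b\<bar>)"

text \<open>Revealing X_j = b moves Pr[X_i = a] by \<open>cov p J i a j b / p j b\<close>. The
  summand is the square of this change weighted by \<open>p j b\<close>, so the sum is the part of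
  the variance of X_i that X_j explains.\<close>

definition variance_drop :: "nat \<Rightarrow> (nat \<Rightarrow> nat \<Rightarrow> real) \<Rightarrow> (nat \<Rightarrow> nat \<Rightarrow> nat \<Rightarrow> nat \<Rightarrow> real)
    \<Rightarrow> nat \<Rightarrow> nat \<Rightarrow> real" where
  "variance_drop k p J i j = (\<Sum>a<k. \<Sum>b<k. (cov p J i a j b)\<^sup>2 / p j b)"

text \<open>Only pairwise consistency is assumed, which is what local distributions provide after
  conditioning on a seed set. No joint law of all variables stands behind \<open>J\<close>.\<close>

locale pairwise_distributions =
  fixes n k :: nat and p :: "nat \<Rightarrow> nat \<Rightarrow> real" and J :: "nat \<Rightarrow> nat \<Rightarrow> nat \<Rightarrow> nat \<Rightarrow> real"
  assumes J_nonneg: "\<And>i a j b. i < n \<Longrightarrow> a < k \<Longrightarrow> j < n \<Longrightarrow> b < k \<Longrightarrow> 0 \<le> J i a j b"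
    and J_sym: "\<And>i a j b. i < n \<Longrightarrow> a < k \<Longrightarrow> j < n \<Longrightarrow> b < k \<Longrightarrow> J i a j b = J j b i a"
    and J_marginal: "\<And>i a j. i < n \<Longrightarrow> a < k \<Longrightarrow> j < n \<Longrightarrow> (\<Sum>b<k. J i a j b) = p i a"
    and p_sum: "\<And>i. i < n \<Longrightarrow> (\<Sum>a<k. p i a) = 1"
begin

lemma p_nonneg: "i < n \<Longrightarrow> a < k \<Longrightarrow> 0 \<le> p i a"
  using J_marginal[of i a i] J_nonneg by (metis lessThan_iff sum_nonneg)

lemma J_le_p:
  assumes "i < n" "a < k" "j < n" "b < k"
  shows "J i a j b \<le> p i a" "J i a j b \<le> p j b"
proof -
  have *: "J i a j b \<le> p i a" if "i < n" "a < k" "j < n" "b < k" for i a j b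
    unfolding J_marginal[OF that(1-3), symmetric]
    by (rule member_le_sum) (use that J_nonneg in auto)
  show "J i a j b \<le> p i a" "J i a j b \<le> p j b"
    using *[OF assms] *[OF assms(3,4,1,2)] J_sym[OF assms] by auto
qed

lemma cov_sym: "i < n \<Longrightarrow> a < k \<Longrightarrow> j < n \<Longrightarrow> b < k \<Longrightarrow> cov p J i a j b = cov p J j b i a"
  using J_sym by (simp add: cov_def mult.commute)

text \<open>\<open>J\<close> is squeezed between 0 and both marginals, so it vanishes together with
  either. This settles the cases of division by zero.\<close>

lemma cov_eq_0:
  assumes "i < n" "a < k" "j < n" "b < k" "p i a = 0 \<or> p j b = 0"
  shows "cov p J i a j b = 0"
proof -
  have "J i a j b = 0"
    using J_le_p[OF assms(1-4)] J_nonneg[OF assms(1-4)] assms(5) by auto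
  thus ?thesis using assms(5) by (auto simp: cov_def)
qed

text \<open>This identity makes the variance drops telescope.\<close>

lemma variance_drop_eq:
  assumes i: "i < n" and j: "j < n"
  shows "variance_drop k p J i j = (\<Sum>a<k. \<Sum>b<k. (J i a j b)\<^sup>2 / p j b) - (\<Sum>a<k. (p i a)\<^sup>2)"
proof -
  have "(\<Sum>b<k. (cov p J i a j b)\<^sup>2 / p j b) = (\<Sum>b<k. (J i a j b)\<^sup>2 / p j b) - (p i a)\<^sup>2"
    if a: "a < k" for a
  proof -
    have "(\<Sum>b<k. (cov p J i a j b)\<^sup>2 / p j b)
        = (\<Sum>b<k. (J i a j b)\<^sup>2 / p j b - 2 * p i a * J i a j b + (p i a)\<^sup>2 * p j b)"
    proof (intro sum.cong refl)
      fix b assume "b \<in> {..<k}"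
      hence b: "b < k" by simp
      show "(cov p J i a j b)\<^sup>2 / p j b
          = (J i a j b)\<^sup>2 / p j b - 2 * p i a * J i a j b + (p i a)\<^sup>2 * p j b"
      proof (cases "p j b = 0")
        case True
        hence "J i a j b = 0" using J_le_p[OF i a j b] J_nonneg[OF i a j b] by simp
        thus ?thesis using True by simp
      next
        case False
        thus ?thesis by (simp add: cov_def field_simps power2_eq_square)
      qed
    qed
    also have "\<dots> = (\<Sum>b<k. (J i a j b)\<^sup>2 / p j b) - 2 * p i a * (\<Sum>b<k. J i a j b) + (p i a)\<^sup>2 * (\<Sum>b<k. p j b)"
      by (simp add: sum.distrib sum_subtractf sum_distrib_left)
    also have "\<dots> = (\<Sum>b<k. (J i a j b)\<^sup>2 / p j b) - (p i a)\<^sup>2"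
      using J_marginal[OF i a j] p_sum[OF j] by (simp add: power2_eq_square)
    finally show ?thesis .
  qed
  thus ?thesis by (simp add: variance_drop_def sum_subtractf)
qed

text \<open>Serves to bound the diagonal of \<open>kernel\<close> by 1. Omit the subtracted squares
  in \<open>variance_drop_eq\<close> and use that \<open>J\<close> is at most the probability by
  which its square is divided.\<close>

lemma variance_drop_le_1:
  assumes i: "i < n" and j: "j < n"
  shows "variance_drop k p J i j \<le> 1"
proof -
  have "variance_drop k p J i j \<le> (\<Sum>a<k. \<Sum>b<k. (J i a j b)\<^sup>2 / p j b)"
    unfolding variance_drop_eq[OF assms] by (simp add: sum_nonneg)
  also have "\<dots> \<le> (\<Sum>a<k. \<Sum>b<k. J i a j b)"
  proof (intro sum_mono)
    fix a b assume "a \<in> {..<k}" "b \<in> {..<k}"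
    hence ab: "a < k" "b < k" by auto
    note J = J_le_p[OF i ab(1) j ab(2)] J_nonneg[OF i ab(1) j ab(2)]
    show "(J i a j b)\<^sup>2 / p j b \<le> J i a j b"
    proof (cases "p j b = 0")
      case False
      hence "0 < p j b" using p_nonneg[OF j ab(2)] by simp
      thus ?thesis using J by (simp add: field_simps power2_eq_square mult_right_mono)
    qed (use J in auto)
  qed
  also have "\<dots> = 1" using J_marginal i j p_sum by simp
  finally show ?thesis .
qed

text \<open>The trivial bound, spent on pairs that meet the discarded vertices.\<close>

lemma pair_dist_le_2:
  assumes i: "i < n" and j: "j < n"
  shows "pair_dist k p J i j \<le> 2"
proof -
  have "pair_dist k p J i j \<le> (\<Sum>a<k. \<Sum>b<k. J i a j b + p i a * p j b)"
    unfolding pair_dist_def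
  proof (intro sum_mono)
    fix a b assume "a \<in> {..<k}" "b \<in> {..<k}"
    thus "\<bar>cov p J i a j b\<bar> \<le> J i a j b + p i a * p j b"
      using J_nonneg[OF i _ j, of a b] p_nonneg[OF i, of a] p_nonneg[OF j, of b]
      by (auto simp: cov_def abs_le_iff add_nonneg_nonneg mult_nonneg_nonneg)
  qed
  also have "\<dots> = (\<Sum>a<k. p i a) + (\<Sum>a<k. p i a) * (\<Sum>b<k. p j b)"
    using J_marginal i j by (simp add: sum.distrib sum_product)
  finally show ?thesis using p_sum i j by simp
qed

text \<open>
  The weights are chosen so that the kernel both dominates the squared distance up to the factor
  \<open>k\<close> and is dominated by the variance drop. Where a probability vanishes, so does the covariance,
  and the quotient is \<open>0 / 0 = 0\<close>.
\<close>

definition kernel :: "nat \<Rightarrow> nat \<Rightarrow> real" where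
  "kernel i j = (\<Sum>a<k. \<Sum>b<k. (cov p J i a j b)\<^sup>2 / (sqrt (p i a) * sqrt (p j b)))"

lemma kernel_nonneg: "i < n \<Longrightarrow> j < n \<Longrightarrow> 0 \<le> kernel i j"
  unfolding kernel_def by (auto intro!: sum_nonneg divide_nonneg_nonneg mult_nonneg_nonneg p_nonneg)

text \<open>The weight in \<open>kernel\<close> is the geometric mean of \<open>1 / p i a\<close>
  and \<open>1 / p j b\<close>, hence at most their arithmetic mean; these are the weights of the
  two drops.\<close>

lemma kernel_le_variance_drop:
  assumes i: "i < n" and j: "j < n"
  shows "kernel i j \<le> (variance_drop k p J i j + variance_drop k p J j i) / 2"
proof -
  have "kernel i j \<le> (\<Sum>a<k. \<Sum>b<k. ((cov p J i a j b)\<^sup>2 / p j b + (cov p J j b i a)\<^sup>2 / p i a) / 2)"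
    unfolding kernel_def
  proof (intro sum_mono)
    fix a b assume "a \<in> {..<k}" "b \<in> {..<k}"
    hence ab: "a < k" "b < k" by auto
    show "(cov p J i a j b)\<^sup>2 / (sqrt (p i a) * sqrt (p j b))
        \<le> ((cov p J i a j b)\<^sup>2 / p j b + (cov p J j b i a)\<^sup>2 / p i a) / 2"
    proof (cases "p i a = 0 \<or> p j b = 0")
      case True
      thus ?thesis using cov_eq_0 cov_sym i j ab by auto
    next
      case False
      define x where "x = 1 / sqrt (p i a)"
      define y where "y = 1 / sqrt (p j b)"
      have pos: "p i a > 0" "p j b > 0"
        using False p_nonneg[OF i ab(1)] p_nonneg[OF j ab(2)] by auto
      have xx: "x * x = 1 / p i a" "y * y = 1 / p j b"
        using pos by (auto simp: x_def y_def)
      have "x * y \<le> (y * y + x * x) / 2"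
        using sum_squares_bound[of x y] by (simp add: power2_eq_square)
      hence "(cov p J i a j b)\<^sup>2 * (x * y) \<le> (cov p J i a j b)\<^sup>2 * ((y * y + x * x) / 2)"
        by (rule mult_left_mono) simp
      thus ?thesis unfolding xx cov_sym[OF j ab(2) i ab(1)]
        by (simp add: x_def y_def field_simps)
    qed
  qed
  also have "\<dots> = ((\<Sum>a<k. \<Sum>b<k. (cov p J i a j b)\<^sup>2 / p j b) + (\<Sum>a<k. \<Sum>b<k. (cov p J j b i a)\<^sup>2 / p i a)) / 2"
    by (simp only: sum.distrib sum_divide_distrib add_divide_distrib)
  also have "(\<Sum>a<k. \<Sum>b<k. (cov p J j b i a)\<^sup>2 / p i a) = variance_drop k p J j i"
    unfolding variance_drop_def by (rule sum.swap)
  finally show ?thesis by (simp add: variance_drop_def)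
qed

text \<open>With \<open>s\<close> the geometric mean of the two marginals, a covariance x satisfies
  \<bar>x\<bar> <= \<delta> s + x^2 / (4 \<delta> s). The result is linear in \<open>kernel\<close>,
  so it can be averaged over constraints and seeds.\<close>

lemma pair_dist_le_kernel:
  assumes i: "i < n" and j: "j < n" and \<eta>: "0 < \<eta>"
  shows "pair_dist k p J i j \<le> \<eta> + k / (4 * \<eta>) * kernel i j"
proof (cases "k = 0")
  case False
  \<comment> \<open>The arithmetic means of the marginals sum to k over all pairs of letters, so
    this choice makes the first term \<eta>.\<close>
  define \<delta> where "\<delta> = \<eta> / k"
  have \<delta>: "\<delta> > 0" using \<eta> False by (simp add: \<delta>_def)
  have lin: "(\<Sum>a<k. \<Sum>b<k. \<delta> * (e a b / 2) + c * g a b)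
      = \<delta> * ((\<Sum>a<k. \<Sum>b<k. e a b) / 2) + c * (\<Sum>a<k. \<Sum>b<k. g a b)" for c and e g :: "nat \<Rightarrow> nat \<Rightarrow> real"
    by (simp add: sum.distrib sum_distrib_left sum_divide_distrib)
  have "pair_dist k p J i j \<le> (\<Sum>a<k. \<Sum>b<k. \<delta> * ((p i a + p j b) / 2)
      + 1 / (4 * \<delta>) * ((cov p J i a j b)\<^sup>2 / (sqrt (p i a) * sqrt (p j b))))"
    unfolding pair_dist_def
  proof (intro sum_mono)
    fix a b assume "a \<in> {..<k}" "b \<in> {..<k}"
    hence ab: "a < k" "b < k" by auto
    have p: "p i a \<ge> 0" "p j b \<ge> 0" using p_nonneg i j ab by auto
    define s where "s = sqrt (p i a) * sqrt (p j b)"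
    have s_le: "s \<le> (p i a + p j b) / 2"
      using sum_squares_bound[of "sqrt (p i a)" "sqrt (p j b)"] p by (simp add: s_def)
    show "\<bar>cov p J i a j b\<bar> \<le> \<delta> * ((p i a + p j b) / 2)
      + 1 / (4 * \<delta>) * ((cov p J i a j b)\<^sup>2 / (sqrt (p i a) * sqrt (p j b)))"
    proof (cases "s = 0")
      case True
      hence "cov p J i a j b = 0" using cov_eq_0[OF i ab(1) j ab(2)] by (simp add: s_def)
      thus ?thesis using p \<delta> by simp
    next
      case False
      hence s: "s > 0" using p by (simp add: s_def less_le)
      define x where "x = \<bar>cov p J i a j b\<bar>"
      have "x = 2 * (\<delta> * s) * x / (2 * (\<delta> * s))" using s \<delta> by simp
      also have "\<dots> \<le> ((\<delta> * s)\<^sup>2 + (x / 2)\<^sup>2) / (\<delta> * s)"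
        using sum_squares_bound[of "\<delta> * s" "x / 2"] s \<delta> by (simp add: field_simps)
      also have "\<dots> = \<delta> * s + 1 / (4 * \<delta>) * (x\<^sup>2 / s)"
        using s \<delta> by (simp add: field_simps power2_eq_square)
      also have "\<dots> \<le> \<delta> * ((p i a + p j b) / 2) + 1 / (4 * \<delta>) * (x\<^sup>2 / s)"
        using s_le \<delta> by simp
      finally show ?thesis by (simp add: x_def s_def)
    qed
  qed
  also have "\<dots> = \<delta> * ((\<Sum>a<k. \<Sum>b<k. p i a + p j b) / 2) + 1 / (4 * \<delta>) * kernel i j"
    unfolding kernel_def by (rule lin)
  also have "(\<Sum>a<k. \<Sum>b<k. p i a + p j b) = 2 * k"
    using p_sum i j by (simp add: sum.distrib sum_distrib_left[symmetric])
  also have "\<delta> * (2 * k / 2) + 1 / (4 * \<delta>) * kernel i j = \<eta> + k / (4 * \<eta>) * kernel i j"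
    using False by (simp add: \<delta>_def)
  finally show ?thesis by simp
qed (use \<eta> in \<open>simp add: pair_dist_def\<close>)

text \<open>The square of an inner product is the inner product of the tensor squares, and the
  weight is a product of a factor for i and one for j. Thus \<open>w (s, t) i\<close> is a
  coordinate of a weighted sum of tensor squares.\<close>

lemma kernel_gram:
  fixes d :: nat
  assumes gram: "\<And>i a j b. i < n \<Longrightarrow> a < k \<Longrightarrow> j < n \<Longrightarrow> b < k \<Longrightarrow>
      cov p J i a j b = (\<Sum>s<d. u i a s * u j b s)"
    and i: "i < n" and j: "j < n"
  defines "w \<equiv> \<lambda>(s, t) i. \<Sum>a<k. u i a s * u i a t / sqrt (p i a)"
  shows "kernel i j = (\<Sum>st\<in>{..<d} \<times> {..<d}. w st i * w st j)"
proof -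
  have "(\<Sum>st\<in>{..<d} \<times> {..<d}. w st i * w st j) = (\<Sum>s<d. \<Sum>t<d. w (s, t) i * w (s, t) j)"
    by (simp add: sum.cartesian_product split_def)
  also have "\<dots>
      = (\<Sum>s<d. \<Sum>t<d. \<Sum>a<k. \<Sum>b<k. (u i a s * u j b s) * (u i a t * u j b t) / (sqrt (p i a) * sqrt (p j b)))"
    by (simp add: w_def sum_product mult_ac)
  also have "\<dots> = (\<Sum>s<d. \<Sum>a<k. \<Sum>t<d. \<Sum>b<k. (u i a s * u j b s) * (u i a t * u j b t) / (sqrt (p i a) * sqrt (p j b)))"
    by (rule sum.cong[OF refl], rule sum.swap)
  also have "\<dots> = (\<Sum>a<k. \<Sum>s<d. \<Sum>t<d. \<Sum>b<k. (u i a s * u j b s) * (u i a t * u j b t) / (sqrt (p i a) * sqrt (p j b)))"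
    by (rule sum.swap)
  also have "\<dots> = (\<Sum>a<k. \<Sum>s<d. \<Sum>b<k. \<Sum>t<d. (u i a s * u j b s) * (u i a t * u j b t) / (sqrt (p i a) * sqrt (p j b)))"
    by (rule sum.cong[OF refl], rule sum.cong[OF refl], rule sum.swap)
  also have "\<dots> = (\<Sum>a<k. \<Sum>b<k. \<Sum>s<d. \<Sum>t<d. (u i a s * u j b s) * (u i a t * u j b t) / (sqrt (p i a) * sqrt (p j b)))"
    by (rule sum.cong[OF refl], rule sum.swap)
  also have "\<dots> = kernel i j"
    unfolding kernel_def
    by (intro sum.cong refl)
      (simp add: gram i j power2_eq_square sum_product sum_divide_distrib)
  finally show ?thesis ..
qed

theorem pair_dist_le_global_correlation:
  fixes \<alpha> :: "nat \<Rightarrow> nat \<Rightarrow> real" and d :: nat and \<tau> K \<eta> :: real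
  assumes gram: "\<And>i a j b. i < n \<Longrightarrow> a < k \<Longrightarrow> j < n \<Longrightarrow> b < k \<Longrightarrow>
      cov p J i a j b = (\<Sum>s<d. u i a s * u j b s)"
    and nonneg: "\<And>i j. i < n \<Longrightarrow> j < n \<Longrightarrow> 0 \<le> \<alpha> i j"
    and row: "\<And>i. i < n \<Longrightarrow> (\<Sum>j<n. \<alpha> i j) = 1"
    and col: "\<And>j. j < n \<Longrightarrow> (\<Sum>i<n. \<alpha> i j) = 1"
    and dec: "spectral_decomposition n \<alpha> l f"
    and m: "m = card {s. s < n \<and> \<tau> < l s}" and \<tau>: "0 \<le> \<tau>"
    and n: "0 < n" and K: "0 < K" and \<eta>: "0 < \<eta>"
  shows "(\<Sum>i<n. \<Sum>j<n. \<alpha> i j * pair_dist k p J i j)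
    \<le> 4 * n / K + \<eta> * n + k / (4 * \<eta>) * (\<tau> * n + K * m / n * (\<Sum>i<n. \<Sum>j<n. variance_drop k p J i j))"
proof -
  let ?w = "\<lambda>(s, t) i. \<Sum>a<k. u i a s * u i a t / sqrt (p i a)"
  have diag: "kernel i i \<le> 1" if "i < n" for i
    using kernel_le_variance_drop[OF that that] variance_drop_le_1[OF that that] by simp
  have kernel_eq: "kernel i j = (\<Sum>st\<in>{..<d} \<times> {..<d}. ?w st i * ?w st j)" if "i < n" "j < n" for i j
    by (rule kernel_gram) (use gram that in auto)
  have le1: "l s \<le> 1" if "s < n" for s
    by (rule stochastic_eigenvalue_le_1[of n \<alpha> l f]) (use nonneg row col dec that in auto)
  obtain X where X: "X \<subseteq> {..<n}" "real (card X) \<le> n / K"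
    and le: "(\<Sum>i<n. \<Sum>j<n. \<alpha> i j * (if i \<in> X \<or> j \<in> X then 0 else kernel i j))
      \<le> \<tau> * n + K * m / n * (\<Sum>i<n. \<Sum>j<n. kernel i j)"
    by (rule local_correlation_le_global[where l = l and f = f and T = "{..<d} \<times> {..<d}" and w = ?w,
          OF dec le1 \<tau> m kernel_eq kernel_nonneg diag K n])
  let ?I = "\<lambda>i. if i \<in> X then 1 else 0 :: real"
  let ?M = "\<lambda>i j. if i \<in> X \<or> j \<in> X then 0 else kernel i j"
  have card_X: "(\<Sum>i<n. ?I i) = card X"
    using X(1) by (simp add: sum.If_cases Int_absorb1)
  \<comment> \<open>Summing over ordered pairs makes the two directions of the drop equal.\<close>
  have avg_drop: "(\<Sum>i<n. \<Sum>j<n. kernel i j) \<le> (\<Sum>i<n. \<Sum>j<n. variance_drop k p J i j)"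
  proof -
    have "(\<Sum>i<n. \<Sum>j<n. kernel i j) \<le> (\<Sum>i<n. \<Sum>j<n. (variance_drop k p J i j + variance_drop k p J j i) / 2)"
      by (intro sum_mono kernel_le_variance_drop) auto
    also have "\<dots> = ((\<Sum>i<n. \<Sum>j<n. variance_drop k p J i j) + (\<Sum>i<n. \<Sum>j<n. variance_drop k p J j i)) / 2"
      by (simp only: sum.distrib sum_divide_distrib add_divide_distrib)
    also have "(\<Sum>i<n. \<Sum>j<n. variance_drop k p J j i) = (\<Sum>i<n. \<Sum>j<n. variance_drop k p J i j)"
      by (rule sum.swap)
    finally show ?thesis by simp
  qed
  \<comment> \<open>A pair that meets \<open>X\<close> pays 2 for each such endpoint. As rows and
    columns of \<open>\<alpha>\<close> sum to 1, each of the two endpoints costs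
    \<open>2 * card X\<close> in total, whence the term \<open>4 * n / K\<close>.\<close>
  have "(\<Sum>i<n. \<Sum>j<n. \<alpha> i j * pair_dist k p J i j)
      \<le> (\<Sum>i<n. \<Sum>j<n. \<alpha> i j * (2 * ?I i + 2 * ?I j + (\<eta> + k / (4 * \<eta>) * ?M i j)))"
  proof (intro sum_mono mult_left_mono)
    fix i j assume "i \<in> {..<n}" "j \<in> {..<n}"
    hence ij: "i < n" "j < n" by auto
    show "pair_dist k p J i j \<le> 2 * ?I i + 2 * ?I j + (\<eta> + k / (4 * \<eta>) * ?M i j)"
      using pair_dist_le_2[OF ij] pair_dist_le_kernel[OF ij \<eta>] \<eta> by auto
  qed (auto intro: nonneg)
  also have "\<dots> = 2 * (\<Sum>i<n. \<Sum>j<n. \<alpha> i j * ?I i) + 2 * (\<Sum>i<n. \<Sum>j<n. \<alpha> i j * ?I j)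
      + \<eta> * (\<Sum>i<n. \<Sum>j<n. \<alpha> i j) + k / (4 * \<eta>) * (\<Sum>i<n. \<Sum>j<n. \<alpha> i j * ?M i j)"
  proof -
    have alg: "x * (2 * y + 2 * z + (\<eta> + c * w)) = 2 * (x * y) + 2 * (x * z) + \<eta> * x + c * (x * w)"
      for x y z c w :: real by (simp add: algebra_simps)
    show ?thesis by (simp only: alg sum.distrib sum_distrib_left)
  qed
  also have "(\<Sum>i<n. \<Sum>j<n. \<alpha> i j * ?I i) = card X"
    unfolding sum_distrib_right[symmetric] card_X[symmetric] by (intro sum.cong refl) (simp add: row)
  also have "(\<Sum>i<n. \<Sum>j<n. \<alpha> i j * ?I j) = (\<Sum>j<n. \<Sum>i<n. \<alpha> i j * ?I j)" by (rule sum.swap)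
  also have "\<dots> = card X"
    unfolding sum_distrib_right[symmetric] card_X[symmetric] by (intro sum.cong refl) (simp add: col)
  also have "(\<Sum>i<n. \<Sum>j<n. \<alpha> i j) = n" by (simp add: row)
  also have "2 * real (card X) + 2 * real (card X) + \<eta> * n + k / (4 * \<eta>) * (\<Sum>i<n. \<Sum>j<n. \<alpha> i j * ?M i j)
      \<le> 2 * (n / K) + 2 * (n / K) + \<eta> * n
        + k / (4 * \<eta>) * (\<tau> * n + K * m / n * (\<Sum>i<n. \<Sum>j<n. variance_drop k p J i j))"
  proof -
    have "(\<Sum>i<n. \<Sum>j<n. \<alpha> i j * ?M i j) \<le> \<tau> * n + K * m / n * (\<Sum>i<n. \<Sum>j<n. variance_drop k p J i j)"
      using le mult_left_mono[OF avg_drop, of "K * m / n"] K by simp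
    thus ?thesis using X(2) \<eta> by (intro add_mono mult_left_mono) auto
  qed
  finally show ?thesis by simp
qed

end

section \<open>Conditioned local distributions\<close>

lemma prob_cong_support:
  assumes "\<And>z. z \<in> set_pmf p \<Longrightarrow> P z \<longleftrightarrow> Q z"
  shows "measure_pmf.prob p {z. P z} = measure_pmf.prob p {z. Q z}"
  by (rule measure_pmf.finite_measure_eq_AE) (use assms in \<open>auto simp: AE_measure_pmf_iff\<close>)

lemma prob_partition:
  assumes "finite F" "\<And>z. z \<in> set_pmf p \<Longrightarrow> R z \<Longrightarrow> h z \<in> F"
  shows "(\<Sum>x\<in>F. measure_pmf.prob p {z. h z = x \<and> R z}) = measure_pmf.prob p {z. R z}"
proof -
  have "(\<Sum>x\<in>F. measure_pmf.prob p {z. h z = x \<and> R z})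
      = measure_pmf.prob p (\<Union>x\<in>F. {z. h z = x \<and> R z})"
    by (rule measure_pmf.finite_measure_finite_Union[symmetric])
      (use assms(1) in \<open>auto simp: disjoint_family_on_def\<close>)
  also have "(\<Union>x\<in>F. {z. h z = x \<and> R z}) = {z. h z \<in> F \<and> R z}" by auto
  also have "measure_pmf.prob p \<dots> = measure_pmf.prob p {z. R z}"
    by (rule prob_cong_support) (use assms(2) in auto)
  finally show ?thesis .
qed

lemma prob_Pi_pmf_pair:
  assumes "finite A" "i \<in> A" "j \<in> A" "i \<noteq> j"
  shows "measure_pmf.prob (Pi_pmf A d q) {y. y i = a \<and> y j = b} = pmf (q i) a * pmf (q j) b"
proof -
  define E where "E l = (if l = i then {a} else if l = j then {b} else UNIV)" for l
  have "{y. y i = a \<and> y j = b} = Pi A E"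
    using assms by (auto simp: E_def Pi_def)
  hence "measure_pmf.prob (Pi_pmf A d q) {y. y i = a \<and> y j = b} = (\<Prod>l\<in>A. measure_pmf.prob (q l) (E l))"
    using measure_Pi_pmf_Pi[OF assms(1)] by simp
  also have "\<dots> = (\<Prod>l\<in>{i, j}. measure_pmf.prob (q l) (E l))"
    by (rule prod.mono_neutral_right) (use assms in \<open>auto simp: E_def\<close>)
  also have "\<dots> = pmf (q i) a * pmf (q j) b"
    using assms(4) by (simp add: E_def measure_pmf_single)
  finally show ?thesis .
qed

lemma prob_Pi_pmf_single:
  assumes "finite A" "i \<in> A"
  shows "measure_pmf.prob (Pi_pmf A d q) {y. y i = a} = pmf (q i) a"
  using arg_cong[OF Pi_pmf_component[OF assms(1), of i d q], of "\<lambda>p. pmf p a"] assms(2)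
  by (simp add: pmf_map vimage_def)

lemma prob_cond_pmf:
  assumes "set_pmf p \<inter> s \<noteq> {}"
  shows "measure_pmf.prob (cond_pmf p s) A = measure_pmf.prob p (s \<inter> A) / measure_pmf.prob p s"
  unfolding cond_pmf.rep_eq[OF assms]
  by (rule measure_uniform_measure) (use emeasure_measure_pmf_not_zero[OF assms] in auto)

locale local_distributions =
  fixes n k r :: nat and \<mu> :: "nat set \<Rightarrow> (nat \<Rightarrow> nat) pmf"
  assumes consistent: "consistent_local_distributions n k r \<mu>"
begin

text \<open>Consistency holds for sets that are \<open>small (r + 2)\<close>. A seed set that is
  \<open>small r\<close> leaves room for two more vertices, one that is \<open>small (r + 1)\<close>
  for a single one.\<close>

definition small :: "nat \<Rightarrow> nat set \<Rightarrow> bool" where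
  "small m T \<longleftrightarrow> T \<subseteq> {..<n} \<and> card T \<le> m"

lemma small_mono: "small m T \<Longrightarrow> m \<le> m' \<Longrightarrow> small m' T"
  by (auto simp: small_def)

lemma small_insert: "small m T \<Longrightarrow> i < n \<Longrightarrow> small (Suc m) (insert i T)"
  by (auto simp: small_def intro: card_insert_le_m1 order_trans[OF card_insert_le_m1])

lemma support: "small (r + 2) T \<Longrightarrow> z \<in> set_pmf (\<mu> T) \<Longrightarrow> z \<in> T \<rightarrow>\<^sub>E {..<k}"
  using consistent unfolding consistent_local_distributions_def small_def by blast

lemma support_less: "small (r + 2) T \<Longrightarrow> z \<in> set_pmf (\<mu> T) \<Longrightarrow> i \<in> T \<Longrightarrow> z i < k"
  using support[of T z] by (auto simp: PiE_def)

lemma restrict_support: "small (r + 2) T \<Longrightarrow> z \<in> set_pmf (\<mu> T) \<Longrightarrow> restrict z T = z"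
  using support[of T z] by (rule PiE_restrict)

lemma finite_support: "small (r + 2) T \<Longrightarrow> finite (set_pmf (\<mu> T))"
proof (rule finite_subset)
  assume T: "small (r + 2) T"
  show "set_pmf (\<mu> T) \<subseteq> T \<rightarrow>\<^sub>E {..<k}" using support[OF T] by blast
  have "finite T" using T unfolding small_def by (meson finite_lessThan finite_subset)
  thus "finite (T \<rightarrow>\<^sub>E {..<k})" by (rule finite_PiE) simp
qed

lemma map_restrict:
  "small (r + 2) T \<Longrightarrow> S \<subseteq> T \<Longrightarrow> map_pmf (\<lambda>z. restrict z S) (\<mu> T) = \<mu> S"
  using consistent unfolding consistent_local_distributions_def small_def by blast

lemma restrict_in_support:
  "small (r + 2) T \<Longrightarrow> S \<subseteq> T \<Longrightarrow> z \<in> set_pmf (\<mu> T) \<Longrightarrow> restrict z S \<in> set_pmf (\<mu> S)"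
  by (subst map_restrict[of T S, symmetric]) auto

lemma prob_marginal:
  assumes "small (r + 2) T" "U \<subseteq> T" "\<And>z. P (restrict z U) = P z"
  shows "measure_pmf.prob (\<mu> U) {z. P z} = measure_pmf.prob (\<mu> T) {z. P z}"
  unfolding map_restrict[OF assms(1,2), symmetric] by (simp add: vimage_def assms(3))

lemma pmf_marginal:
  assumes "small (r + 2) T" "S \<subseteq> T"
  shows "pmf (\<mu> S) x = measure_pmf.prob (\<mu> T) {z. restrict z S = x}"
  unfolding map_restrict[OF assms, symmetric] by (simp add: pmf_map vimage_def)

text \<open>Conditional laws given X_S = x, as quotients instead of \<open>cond_pmf\<close>: they
  are defined without a support condition, and the vertices may lie in \<open>S\<close> or
  coincide.\<close>

definition cond1 :: "nat set \<Rightarrow> (nat \<Rightarrow> nat) \<Rightarrow> nat \<Rightarrow> nat \<Rightarrow> real" where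
  "cond1 S x i a =
     measure_pmf.prob (\<mu> (insert i S)) {z. restrict z S = x \<and> z i = a} / pmf (\<mu> S) x"

definition cond2 :: "nat set \<Rightarrow> (nat \<Rightarrow> nat) \<Rightarrow> nat \<Rightarrow> nat \<Rightarrow> nat \<Rightarrow> nat \<Rightarrow> real" where
  "cond2 S x i a j b =
     measure_pmf.prob (\<mu> (insert i (insert j S))) {z. restrict z S = x \<and> z i = a \<and> z j = b}
       / pmf (\<mu> S) x"

lemma cond1_nonneg: "0 \<le> cond1 S x i a"
  by (simp add: cond1_def)

lemma cond1_sum:
  assumes S: "small (r + 1) S" and i: "i < n" and x: "x \<in> set_pmf (\<mu> S)"
  shows "(\<Sum>a<k. cond1 S x i a) = 1"
proof -
  have T: "small (r + 2) (insert i S)" using small_insert[OF S i] by simp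
  have "(\<Sum>a<k. measure_pmf.prob (\<mu> (insert i S)) {z. z i = a \<and> restrict z S = x})
      = measure_pmf.prob (\<mu> (insert i S)) {z. restrict z S = x}"
    by (rule prob_partition) (use support_less[OF T] in auto)
  also have "\<dots> = pmf (\<mu> S) x" by (rule pmf_marginal[OF T, symmetric]) auto
  finally show ?thesis
    using x by (simp add: cond1_def sum_divide_distrib[symmetric] set_pmf_iff conj_commute)
qed

lemma cond2_sum:
  assumes S: "small r S" and i: "i < n" and j: "j < n"
  shows "(\<Sum>b<k. cond2 S x i a j b) = cond1 S x i a"
proof -
  have T: "small (r + 2) (insert i (insert j S))"
    using small_insert[OF small_insert[OF S j] i] by simp
  have "(\<Sum>b<k. measure_pmf.prob (\<mu> (insert i (insert j S))) {z. z j = b \<and> restrict z S = x \<and> z i = a})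
      = measure_pmf.prob (\<mu> (insert i (insert j S))) {z. restrict z S = x \<and> z i = a}"
    by (rule prob_partition) (use support_less[OF T] in auto)
  also have "\<dots> = measure_pmf.prob (\<mu> (insert i S)) {z. restrict z S = x \<and> z i = a}"
    by (rule prob_marginal[OF T, symmetric]) (auto simp: restrict_def fun_eq_iff)
  finally have "(\<Sum>b<k. measure_pmf.prob (\<mu> (insert i (insert j S))) {z. restrict z S = x \<and> z i = a \<and> z j = b})
      = measure_pmf.prob (\<mu> (insert i S)) {z. restrict z S = x \<and> z i = a}"
    by (simp add: conj_ac)
  thus ?thesis by (simp add: cond1_def cond2_def sum_divide_distrib[symmetric])
qed

lemma pairwise_cond:
  assumes S: "small r S" and x: "x \<in> set_pmf (\<mu> S)"
  shows "pairwise_distributions n k (cond1 S x) (cond2 S x)"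
proof
  show "cond2 S x i a j b = cond2 S x j b i a" for i a j b
    by (simp add: cond2_def insert_commute conj_ac)
  show "(\<Sum>a<k. cond1 S x i a) = 1" if "i < n" for i
    using cond1_sum small_mono[OF S] that x by simp
qed (auto simp: cond2_def cond2_sum[OF S, unfolded cond2_def])

lemma cond2_diag:
  assumes S: "small r S" and i: "i < n"
  shows "cond2 S x i a i b = (if a = b then cond1 S x i a else 0)"
proof -
  have "{z. restrict z S = x \<and> z i = a \<and> z i = b}
      = (if a = b then {z. restrict z S = x \<and> z i = a} else {})" by auto
  thus ?thesis by (auto simp: cond2_def cond1_def)
qed

section \<open>Revealing one more vertex\<close>

text \<open>Disintegration: an outcome on \<open>insert j S\<close> is drawn by drawing X_S first
  and then X_j from its conditional law. For \<open>j\<close> in \<open>S\<close> the second draw is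
  deterministic.\<close>

lemma expectation_insert:
  assumes S: "small (r + 1) S" and j: "j < n"
  shows "measure_pmf.expectation (\<mu> (insert j S)) (\<lambda>z. g (restrict z S) (z j))
    = measure_pmf.expectation (\<mu> S) (\<lambda>x. \<Sum>b<k. cond1 S x j b * g x b :: real)"
proof -
  let ?T = "insert j S"
  have T: "small (r + 2) ?T" using small_insert[OF S j] by simp
  have S': "small (r + 2) S" using small_mono[OF S] by simp
  define \<nu> where "\<nu> = map_pmf (\<lambda>z. (restrict z S, z j)) (\<mu> ?T)"
  have pmf_\<nu>: "pmf \<nu> (x, b) = pmf (\<mu> S) x * cond1 S x j b" if "x \<in> set_pmf (\<mu> S)" for x b
    using that by (simp add: \<nu>_def pmf_map vimage_def cond1_def set_pmf_iff)
  have "measure_pmf.expectation (\<mu> ?T) (\<lambda>z. g (restrict z S) (z j))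
      = measure_pmf.expectation \<nu> (\<lambda>(x, b). g x b)"
    by (simp add: \<nu>_def)
  also have "\<dots> = (\<Sum>xb\<in>set_pmf (\<mu> S) \<times> {..<k}. pmf \<nu> xb *\<^sub>R (case xb of (x, b) \<Rightarrow> g x b))"
  proof (rule integral_measure_pmf)
    show "finite (set_pmf (\<mu> S) \<times> {..<k})" using finite_support[OF S'] by simp
    show "xb \<in> set_pmf (\<mu> S) \<times> {..<k}" if "xb \<in> set_pmf \<nu>" for xb
      using that restrict_in_support[OF T, of S] support_less[OF T] by (auto simp: \<nu>_def)
  qed
  also have "\<dots> = (\<Sum>x\<in>set_pmf (\<mu> S). \<Sum>b<k. pmf \<nu> (x, b) * g x b)"
    by (simp add: sum.cartesian_product split_def)
  also have "\<dots> = (\<Sum>x\<in>set_pmf (\<mu> S). pmf (\<mu> S) x * (\<Sum>b<k. cond1 S x j b * g x b))"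
    by (intro sum.cong refl) (simp add: pmf_\<nu> sum_distrib_left mult.assoc)
  also have "\<dots> = measure_pmf.expectation (\<mu> S) (\<lambda>x. \<Sum>b<k. cond1 S x j b * g x b)"
    by (subst integral_measure_pmf[OF finite_support[OF S']]) auto
  finally show ?thesis .
qed

text \<open>Conditioning in two stages: the outcome \<open>z\<close> on \<open>insert j S\<close>
  amounts to its restriction to \<open>S\<close> together with \<open>z j\<close>, and the
  probability of the first stage cancels.\<close>

lemma cond1_insert:
  assumes S: "small r S" and i: "i < n" and j: "j < n" and z: "z \<in> set_pmf (\<mu> (insert j S))"
  shows "cond1 (insert j S) z i a
    = cond2 S (restrict z S) i a j (z j) / cond1 S (restrict z S) j (z j)"
proof -
  let ?T = "insert j S"
  have T: "small (r + 2) ?T" using small_mono[OF small_insert[OF S j], of "r + 2"] by simp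
  have iff: "restrict w ?T = z \<longleftrightarrow> restrict w S = restrict z S \<and> w j = z j" for w
  proof -
    have "restrict w ?T = z \<longleftrightarrow> restrict w ?T = restrict z ?T"
      using restrict_support[OF T z] by simp
    also have "\<dots> \<longleftrightarrow> restrict w S = restrict z S \<and> w j = z j"
      by (auto simp: restrict_def fun_eq_iff)
    finally show ?thesis .
  qed
  have "pmf (\<mu> ?T) z = measure_pmf.prob (\<mu> ?T) {w. restrict w S = restrict z S \<and> w j = z j}"
    by (subst pmf_marginal[OF T order_refl]) (simp add: iff)
  moreover have "restrict z S \<in> set_pmf (\<mu> S)" by (rule restrict_in_support[OF T _ z]) auto
  ultimately show ?thesis
    by (simp add: cond1_def cond2_def iff set_pmf_iff conj_ac)
qed

text \<open>With p = Pr[X_j = b] and J the joint probability, both given X_S, the outcome b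
  contributes p (J / p)^2 = J^2 / p. This is the first term in
  \<open>variance_drop_eq\<close>.\<close>

lemma expectation_square_insert:
  assumes S: "small r S" and i: "i < n" and j: "j < n"
  shows "measure_pmf.expectation (\<mu> (insert j S)) (\<lambda>z. \<Sum>a<k. (cond1 (insert j S) z i a)\<^sup>2)
    = measure_pmf.expectation (\<mu> S) (\<lambda>x. \<Sum>a<k. \<Sum>b<k. (cond2 S x i a j b)\<^sup>2 / cond1 S x j b)"
proof -
  have "measure_pmf.expectation (\<mu> (insert j S)) (\<lambda>z. \<Sum>a<k. (cond1 (insert j S) z i a)\<^sup>2)
      = measure_pmf.expectation (\<mu> (insert j S))
          (\<lambda>z. \<Sum>a<k. (cond2 S (restrict z S) i a j (z j) / cond1 S (restrict z S) j (z j))\<^sup>2)"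
    by (rule integral_cong_AE) (use cond1_insert[OF S i j] in \<open>auto simp: AE_measure_pmf_iff\<close>)
  also have "\<dots> = measure_pmf.expectation (\<mu> S)
      (\<lambda>x. \<Sum>b<k. cond1 S x j b * (\<Sum>a<k. (cond2 S x i a j b / cond1 S x j b)\<^sup>2))"
    by (rule expectation_insert[where g = "\<lambda>x b. \<Sum>a<k. (cond2 S x i a j b / cond1 S x j b)\<^sup>2"])
      (use small_mono[OF S] j in auto)
  also have "(\<lambda>x. \<Sum>b<k. cond1 S x j b * (\<Sum>a<k. (cond2 S x i a j b / cond1 S x j b)\<^sup>2))
      = (\<lambda>x. \<Sum>b<k. \<Sum>a<k. (cond2 S x i a j b)\<^sup>2 / cond1 S x j b)"
  proof (intro ext sum.cong refl)
    fix x b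
    show "cond1 S x j b * (\<Sum>a<k. (cond2 S x i a j b / cond1 S x j b)\<^sup>2)
        = (\<Sum>a<k. (cond2 S x i a j b)\<^sup>2 / cond1 S x j b)"
      \<comment> \<open>If the probability is 0, both sides vanish by the convention for division by
        zero.\<close>
      by (cases "cond1 S x j b = 0") (simp_all add: sum_distrib_left power2_eq_square)
  qed
  also have "\<dots> = (\<lambda>x. \<Sum>a<k. \<Sum>b<k. (cond2 S x i a j b)\<^sup>2 / cond1 S x j b)"
    by (rule ext, rule sum.swap)
  finally show ?thesis .
qed

text \<open>Up to sign and an additive constant, the total conditional variance of the \<open>X\<^sub>i\<close> given \<open>X\<^sub>S\<close>.\<close>

definition energy :: "nat set \<Rightarrow> real" where
  "energy S = (\<Sum>i<n. measure_pmf.expectation (\<mu> S) (\<lambda>x. \<Sum>a<k. (cond1 S x i a)\<^sup>2))"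

lemma energy_nonneg: "0 \<le> energy S"
  unfolding energy_def by (intro sum_nonneg integral_nonneg_AE) (simp add: sum_nonneg)

lemma energy_le:
  assumes S: "small (r + 1) S"
  shows "energy S \<le> n"
proof -
  have S': "small (r + 2) S" using small_mono[OF S] by simp
  have "measure_pmf.expectation (\<mu> S) (\<lambda>x. \<Sum>a<k. (cond1 S x i a)\<^sup>2) \<le> 1" if i: "i < n" for i
  proof -
    have "(\<Sum>a<k. (cond1 S x i a)\<^sup>2) \<le> 1" if x: "x \<in> set_pmf (\<mu> S)" for x
    proof -
      have "(\<Sum>a<k. (cond1 S x i a)\<^sup>2) \<le> (\<Sum>a<k. cond1 S x i a)"
      proof (rule sum_mono)
        fix a assume a: "a \<in> {..<k}"
        have "cond1 S x i a \<le> (\<Sum>a<k. cond1 S x i a)"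
          by (rule member_le_sum) (use a cond1_nonneg in auto)
        hence "cond1 S x i a \<le> 1" using cond1_sum[OF S i x] by simp
        thus "(cond1 S x i a)\<^sup>2 \<le> cond1 S x i a"
          using cond1_nonneg[of S x i a] by (simp add: power2_eq_square mult_left_le)
      qed
      thus ?thesis using cond1_sum[OF S i x] by simp
    qed
    hence "measure_pmf.expectation (\<mu> S) (\<lambda>x. \<Sum>a<k. (cond1 S x i a)\<^sup>2)
        \<le> measure_pmf.expectation (\<mu> S) (\<lambda>x. 1)"
      by (intro integral_mono_AE integrable_measure_pmf_finite finite_support[OF S'])
        (auto simp: AE_measure_pmf_iff)
    thus ?thesis by simp
  qed
  hence "energy S \<le> (\<Sum>i<n. 1)" unfolding energy_def by (intro sum_mono) auto
  thus ?thesis by simp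
qed

text \<open>By \<open>variance_drop_eq\<close>, the drops caused by \<open>j\<close> average to the
  gain in energy when \<open>j\<close> joins \<open>S\<close>. Summed over all \<open>j\<close>, the
  energy of \<open>S\<close> is subtracted n times.\<close>

lemma expectation_variance_drop:
  assumes S: "small r S"
  shows "measure_pmf.expectation (\<mu> S) (\<lambda>x. \<Sum>i<n. \<Sum>j<n. variance_drop k (cond1 S x) (cond2 S x) i j)
    = (\<Sum>j<n. energy (insert j S)) - n * energy S"
proof -
  have S': "small (r + 2) S" using small_mono[OF S] by simp
  have int: "integrable (measure_pmf (\<mu> S)) f" for f :: "_ \<Rightarrow> real"
    by (intro integrable_measure_pmf_finite finite_support[OF S'])
  have "measure_pmf.expectation (\<mu> S) (\<lambda>x. \<Sum>i<n. \<Sum>j<n. variance_drop k (cond1 S x) (cond2 S x) i j)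
      = measure_pmf.expectation (\<mu> S) (\<lambda>x. \<Sum>i<n. \<Sum>j<n.
          (\<Sum>a<k. \<Sum>b<k. (cond2 S x i a j b)\<^sup>2 / cond1 S x j b) - (\<Sum>a<k. (cond1 S x i a)\<^sup>2))"
  proof (rule integral_cong_AE)
    show "AE x in measure_pmf (\<mu> S).
        (\<Sum>i<n. \<Sum>j<n. variance_drop k (cond1 S x) (cond2 S x) i j) = (\<Sum>i<n. \<Sum>j<n.
          (\<Sum>a<k. \<Sum>b<k. (cond2 S x i a j b)\<^sup>2 / cond1 S x j b) - (\<Sum>a<k. (cond1 S x i a)\<^sup>2))"
      unfolding AE_measure_pmf_iff
    proof
      fix x assume "x \<in> set_pmf (\<mu> S)"
      then interpret pairwise_distributions n k "cond1 S x" "cond2 S x" by (rule pairwise_cond[OF S])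
      show "(\<Sum>i<n. \<Sum>j<n. variance_drop k (cond1 S x) (cond2 S x) i j) = (\<Sum>i<n. \<Sum>j<n.
          (\<Sum>a<k. \<Sum>b<k. (cond2 S x i a j b)\<^sup>2 / cond1 S x j b) - (\<Sum>a<k. (cond1 S x i a)\<^sup>2))"
        by (intro sum.cong refl) (simp add: variance_drop_eq)
    qed
  qed auto
  also have "\<dots> = (\<Sum>i<n. \<Sum>j<n.
        measure_pmf.expectation (\<mu> S) (\<lambda>x. \<Sum>a<k. \<Sum>b<k. (cond2 S x i a j b)\<^sup>2 / cond1 S x j b)
      - measure_pmf.expectation (\<mu> S) (\<lambda>x. \<Sum>a<k. (cond1 S x i a)\<^sup>2))"
    by (simp only: Bochner_Integration.integral_sum[OF int] Bochner_Integration.integral_diff[OF int int])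
  also have "\<dots> = (\<Sum>i<n. \<Sum>j<n.
        measure_pmf.expectation (\<mu> (insert j S)) (\<lambda>z. \<Sum>a<k. (cond1 (insert j S) z i a)\<^sup>2)
      - measure_pmf.expectation (\<mu> S) (\<lambda>x. \<Sum>a<k. (cond1 S x i a)\<^sup>2))"
    by (intro sum.cong refl) (simp add: expectation_square_insert[OF S])
  also have "\<dots> = (\<Sum>i<n. \<Sum>j<n. measure_pmf.expectation (\<mu> (insert j S)) (\<lambda>z. \<Sum>a<k. (cond1 (insert j S) z i a)\<^sup>2))
      - n * energy S"
    by (simp add: sum_subtractf energy_def sum_distrib_left)
  also have "(\<Sum>i<n. \<Sum>j<n. measure_pmf.expectation (\<mu> (insert j S)) (\<lambda>z. \<Sum>a<k. (cond1 (insert j S) z i a)\<^sup>2))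
      = (\<Sum>j<n. energy (insert j S))"
    unfolding energy_def by (rule sum.swap)
  finally show ?thesis .
qed

section \<open>The law of the rounded assignment\<close>

lemma pmf_cond_marginal:
  assumes S: "small (r + 1) S" and x: "x \<in> set_pmf (\<mu> S)" and i: "i < n"
  shows "pmf (map_pmf (\<lambda>z. z i) (cond_pmf (\<mu> (insert i S)) {z. restrict z S = x})) a = cond1 S x i a"
proof -
  have T: "small (r + 2) (insert i S)" using small_insert[OF S i] by simp
  \<comment> \<open>By consistency \<open>x\<close> extends to an outcome on
    \<open>insert i S\<close>, so the conditioning event is possible.\<close>
  have "x \<in> (\<lambda>z. restrict z S) ` set_pmf (\<mu> (insert i S))"
    using x map_restrict[OF T, of S] by (metis set_map_pmf subset_insertI)
  hence "set_pmf (\<mu> (insert i S)) \<inter> {z. restrict z S = x} \<noteq> {}" by auto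
  thus ?thesis
    using pmf_marginal[OF T, of S x]
    by (simp add: pmf_map prob_cond_pmf cond1_def vimage_def Collect_conj_eq[symmetric] subset_insertI)
qed

lemma cond1_of_mem:
  assumes S: "small (r + 1) S" and x: "x \<in> set_pmf (\<mu> S)" and i: "i \<in> S"
  shows "cond1 S x i a = (if x i = a then 1 else 0)"
proof -
  have S': "small (r + 2) S" using small_mono[OF S] by simp
  have "measure_pmf.prob (\<mu> S) {z. restrict z S = x \<and> z i = a}
      = measure_pmf.prob (\<mu> S) {z. z = x \<and> x i = a}"
    by (rule prob_cong_support) (use restrict_support[OF S'] in auto)
  also have "\<dots> = (if x i = a then pmf (\<mu> S) x else 0)"
    by (simp add: measure_pmf_single)
  finally show ?thesis using x i by (simp add: cond1_def insert_absorb set_pmf_iff)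
qed

lemma propagate_single:
  assumes S: "small (r + 1) S" and x: "x \<in> set_pmf (\<mu> S)" and i: "i < n"
  shows "measure_pmf.prob (propagate n \<mu> S x) {y. y i = a} = cond1 S x i a"
proof (cases "i \<in> S")
  case True
  thus ?thesis by (simp add: propagate_def vimage_def cond1_of_mem[OF S x])
next
  case False
  thus ?thesis using i
    by (simp add: propagate_def vimage_def prob_Pi_pmf_single pmf_cond_marginal[OF S x])
qed

text \<open>A vertex of \<open>S\<close> has a constant value, which reduces the claim to a single
  coordinate; two vertices outside \<open>S\<close> are rounded independently. A vertex is not
  independent of itself, hence \<open>i \<noteq> j\<close>.\<close>

lemma propagate_pair:
  assumes S: "small (r + 1) S" and x: "x \<in> set_pmf (\<mu> S)" and ij: "i < n" "j < n" "i \<noteq> j"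
  shows "measure_pmf.prob (propagate n \<mu> S x) {y. y i = a \<and> y j = b} = cond1 S x i a * cond1 S x j b"
proof (cases "i \<in> S \<or> j \<in> S")
  case True
  have "measure_pmf.prob (propagate n \<mu> S x) {y. y i = a \<and> y j = b}
      = (if i \<in> S then (if x i = a then measure_pmf.prob (propagate n \<mu> S x) {y. y j = b} else 0)
         else (if x j = b then measure_pmf.prob (propagate n \<mu> S x) {y. y i = a} else 0))"
    using True by (auto simp: propagate_def vimage_def)
  thus ?thesis using True ij
    by (auto simp: propagate_single[OF S x] cond1_of_mem[OF S x])
next
  case False
  thus ?thesis using ij
    by (simp add: propagate_def vimage_def prob_Pi_pmf_pair pmf_cond_marginal[OF S x])
qed

lemma finite_set_propagate:
  assumes S: "small (r + 1) S" and x: "x \<in> set_pmf (\<mu> S)"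
  shows "finite (set_pmf (propagate n \<mu> S x))"
proof -
  have "finite (set_pmf (map_pmf (\<lambda>z. z i) (cond_pmf (\<mu> (insert i S)) {z. restrict z S = x})))"
    if "i < n" for i
  proof -
    have T: "small (r + 2) (insert i S)" using small_insert[OF S that] by simp
    have "x \<in> (\<lambda>z. restrict z S) ` set_pmf (\<mu> (insert i S))"
      using x map_restrict[OF T, of S] by (metis set_map_pmf subset_insertI)
    hence "set_pmf (\<mu> (insert i S)) \<inter> {z. restrict z S = x} \<noteq> {}" by auto
    thus ?thesis using finite_support[OF T] by simp
  qed
  thus ?thesis by (auto simp: propagate_def set_Pi_pmf intro!: finite_imageI finite_PiE_dflt)
qed

text \<open>Two distinct vertices follow the product law after rounding, so each accepted pair of
  letters loses at most its absolute covariance. Extending the sum to all pairs of letters gives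
  \<open>pair_dist\<close>.\<close>

lemma propagate_ge:
  assumes S: "small r S" and x: "x \<in> set_pmf (\<mu> S)" and i: "i < n" and j: "j < n"
  shows "measure_pmf.prob (propagate n \<mu> S x) {y. (y i, y j) \<in> P}
    \<ge> (\<Sum>(a, b)\<in>P \<inter> ({..<k} \<times> {..<k}). cond2 S x i a j b) - pair_dist k (cond1 S x) (cond2 S x) i j"
proof -
  let ?P = "P \<inter> ({..<k} \<times> {..<k})" and ?c = "\<lambda>(a, b). \<bar>cov (cond1 S x) (cond2 S x) i a j b\<bar>"
  let ?pr = "measure_pmf.prob (propagate n \<mu> S x)"
  have S1: "small (r + 1) S" using small_mono[OF S] by simp
  have fin: "finite ?P" by simp
  have "(\<Sum>ab\<in>?P. ?c ab) \<le> (\<Sum>ab\<in>{..<k} \<times> {..<k}. ?c ab)"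
    by (rule sum_mono2) auto
  also have "\<dots> = pair_dist k (cond1 S x) (cond2 S x) i j"
    by (simp add: pair_dist_def sum.cartesian_product)
  finally have "(\<Sum>(a, b)\<in>?P. cond2 S x i a j b) - pair_dist k (cond1 S x) (cond2 S x) i j
      \<le> (\<Sum>(a, b)\<in>?P. cond2 S x i a j b) - (\<Sum>ab\<in>?P. ?c ab)"
    by (rule diff_left_mono)
  also have "\<dots> = (\<Sum>ab\<in>?P. (case ab of (a, b) \<Rightarrow> cond2 S x i a j b) - ?c ab)"
    by (rule sum_subtractf[symmetric])
  also have "\<dots> \<le> (\<Sum>ab\<in>?P. ?pr {y. (y i, y j) = ab})"
  proof (rule sum_mono)
    fix ab assume "ab \<in> ?P"
    obtain a b where ab: "ab = (a, b)" by fastforce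
    have "cond2 S x i a j b - \<bar>cov (cond1 S x) (cond2 S x) i a j b\<bar> \<le> ?pr {y. y i = a \<and> y j = b}"
    proof (cases "i = j")
      \<comment> \<open>On a loop, rounding reproduces the conditional law exactly; subtracting a
        covariance only weakens the bound.\<close>
      case True
      have "{y. y i = a \<and> y i = b} = (if a = b then {y. y i = a} else {})" by auto
      hence "cond2 S x i a j b = ?pr {y. y i = a \<and> y j = b}"
        unfolding True[symmetric] cond2_diag[OF S i] by (simp add: propagate_single[OF S1 x i])
      thus ?thesis by simp
    next
      case False
      have "?pr {y. y i = a \<and> y j = b} = cond2 S x i a j b - cov (cond1 S x) (cond2 S x) i a j b"
        by (simp add: propagate_pair[OF S1 x i j False] cov_def)
      thus ?thesis by linarith
    qed
    thus "(case ab of (a, b) \<Rightarrow> cond2 S x i a j b) - ?c ab \<le> ?pr {y. (y i, y j) = ab}"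
      by (simp add: ab)
  qed
  also have "\<dots> = ?pr (\<Union>ab\<in>?P. {y. (y i, y j) = ab})"
    by (rule measure_pmf.finite_measure_finite_Union[symmetric])
      (auto simp: disjoint_family_on_def)
  also have "\<dots> \<le> ?pr {y. (y i, y j) \<in> P}"
    by (rule measure_pmf.finite_measure_mono) auto
  finally show ?thesis .
qed

text \<open>The law of total probability over the seed values, followed by consistency: conditioning
  does not change the value on average.\<close>

lemma expectation_cond2:
  assumes S: "small r S" and i: "i < n" and j: "j < n"
  shows "measure_pmf.expectation (\<mu> S) (\<lambda>x. \<Sum>(a, b)\<in>P \<inter> ({..<k} \<times> {..<k}). cond2 S x i a j b)
    = measure_pmf.prob (\<mu> {i, j}) {z. (z i, z j) \<in> P}"
proof -
  let ?P = "P \<inter> ({..<k} \<times> {..<k})" and ?T = "insert i (insert j S)"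
  have S': "small (r + 2) S" using small_mono[OF S] by simp
  have T: "small (r + 2) ?T" using small_insert[OF small_insert[OF S j] i] by simp
  have "measure_pmf.expectation (\<mu> S) (\<lambda>x. \<Sum>(a, b)\<in>?P. cond2 S x i a j b)
      = (\<Sum>x\<in>set_pmf (\<mu> S). pmf (\<mu> S) x * (\<Sum>(a, b)\<in>?P. cond2 S x i a j b))"
    by (subst integral_measure_pmf[OF finite_support[OF S']]) auto
  also have "\<dots> = (\<Sum>x\<in>set_pmf (\<mu> S). \<Sum>ab\<in>?P.
      measure_pmf.prob (\<mu> ?T) {z. restrict z S = x \<and> (z i, z j) = ab})"
    by (intro sum.cong refl)
      (auto simp: sum_distrib_left cond2_def set_pmf_iff split_def intro!: sum.cong
        arg_cong[of _ _ "measure_pmf.prob (\<mu> ?T)"])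
  also have "\<dots> = (\<Sum>ab\<in>?P. \<Sum>x\<in>set_pmf (\<mu> S).
      measure_pmf.prob (\<mu> ?T) {z. restrict z S = x \<and> (z i, z j) = ab})"
    by (rule sum.swap)
  also have "\<dots> = (\<Sum>ab\<in>?P. measure_pmf.prob (\<mu> ?T) {z. (z i, z j) = ab})"
    by (intro sum.cong refl prob_partition)
      (use finite_support[OF S'] restrict_in_support[OF T, of S] in auto)
  \<comment> \<open>The added conjunct makes the events a partition of
    \<open>(z i, z j) \<in> P\<close>, as \<open>prob_partition\<close> requires.\<close>
  also have "\<dots> = (\<Sum>ab\<in>?P. measure_pmf.prob (\<mu> ?T) {z. (z i, z j) = ab \<and> (z i, z j) \<in> P})"
    by (intro sum.cong refl prob_cong_support) auto
  also have "\<dots> = measure_pmf.prob (\<mu> ?T) {z. (z i, z j) \<in> P}"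
    by (rule prob_partition) (use support_less[OF T] in auto)
  also have "\<dots> = measure_pmf.prob (\<mu> {i, j}) {z. (z i, z j) \<in> P}"
    by (rule prob_marginal[OF T, symmetric]) auto
  finally show ?thesis .
qed

end

section \<open>Conditioned vectors\<close>

locale lasserre_vectors =
  fixes n k r :: nat and \<mu> :: "nat set \<Rightarrow> (nat \<Rightarrow> nat) pmf" and v :: "nat set \<Rightarrow> (nat \<Rightarrow> nat) \<Rightarrow> real vec"
  assumes solution: "lasserre_solution n k r \<mu> v"
begin

sublocale local_distributions n k r \<mu>
  by unfold_locales (use solution in \<open>simp add: lasserre_solution_def\<close>)

text \<open>
  The squared length of this vector is the probability that \<open>X\<^sub>S = x\<close> and \<open>X\<^sub>i = a\<close>; in the
  contradictory case the update \<open>x(i := a)\<close> would forget the value of \<open>x\<close> at \<open>i\<close>.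
\<close>

definition cond_vec :: "nat set \<Rightarrow> (nat \<Rightarrow> nat) \<Rightarrow> nat \<Rightarrow> nat \<Rightarrow> nat \<Rightarrow> real" where
  "cond_vec S x i a s = (if i \<in> S \<and> x i \<noteq> a then 0 else vec_index (v (insert i S) (x(i := a))) s)"

text \<open>The Lasserre vectors for \<open>X\<^sub>S = x\<close> extended by one vertex, with their
  components along \<open>v S x\<close> removed, have the conditional covariances as inner products
  up to scaling. Two extensions involve at most r + 2 vertices, where the inner products are
  known.\<close>

lemma cond_covariance_gram:
  assumes S: "small r S" and x: "x \<in> set_pmf (\<mu> S)"
  shows "\<exists>(d :: nat) u. \<forall>i a j b. i < n \<longrightarrow> a < k \<longrightarrow> j < n \<longrightarrow> b < k \<longrightarrow>
    cov (cond1 S x) (cond2 S x) i a j b = (\<Sum>s<d. u i a s * u j b s)"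
proof -
  have "\<exists>d. \<forall>S \<subseteq> {..<n}. card S \<le> r + 2 \<longrightarrow> (\<forall>\<alpha> \<in> S \<rightarrow>\<^sub>E {..<k}. v S \<alpha> \<in> carrier_vec d)"
    using solution unfolding lasserre_solution_def by (elim conjE)
  then obtain d where "\<forall>S \<subseteq> {..<n}. card S \<le> r + 2 \<longrightarrow> (\<forall>\<alpha> \<in> S \<rightarrow>\<^sub>E {..<k}. v S \<alpha> \<in> carrier_vec d)" ..
  hence d: "v T \<alpha> \<in> carrier_vec d" if "small (r + 2) T" "\<alpha> \<in> T \<rightarrow>\<^sub>E {..<k}" for T \<alpha>
    using that by (simp add: small_def)
  have prod: "scalar_prod (v T \<alpha>) (v U \<beta>)
      = measure_pmf.prob (\<mu> (T \<union> U)) {z. restrict z T = \<alpha> \<and> restrict z U = \<beta>}"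
    if "T \<subseteq> {..<n}" "U \<subseteq> {..<n}" "card (T \<union> U) \<le> r + 2" "\<alpha> \<in> T \<rightarrow>\<^sub>E {..<k}" "\<beta> \<in> U \<rightarrow>\<^sub>E {..<k}" for T U \<alpha> \<beta>
  proof -
    have "\<forall>S \<subseteq> {..<n}. \<forall>T \<subseteq> {..<n}. card (S \<union> T) \<le> r + 2 \<longrightarrow>
        (\<forall>\<alpha> \<in> S \<rightarrow>\<^sub>E {..<k}. \<forall>\<beta> \<in> T \<rightarrow>\<^sub>E {..<k}.
           scalar_prod (v S \<alpha>) (v T \<beta>) =
             measure_pmf.prob (\<mu> (S \<union> T)) {x. restrict x S = \<alpha> \<and> restrict x T = \<beta>})"
      using solution unfolding lasserre_solution_def by (elim conjE)
    thus ?thesis using that by simp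
  qed
  have ip: "(\<Sum>s<d. vec_index (v T \<alpha>) s * vec_index (v U \<beta>) s)
      = measure_pmf.prob (\<mu> (T \<union> U)) {z. restrict z T = \<alpha> \<and> restrict z U = \<beta>}"
    if "small (r + 2) (T \<union> U)" "\<alpha> \<in> T \<rightarrow>\<^sub>E {..<k}" "\<beta> \<in> U \<rightarrow>\<^sub>E {..<k}" for T U \<alpha> \<beta>
  proof -
    have fin: "finite (T \<union> U)" using that(1) by (auto simp: small_def intro: finite_subset)
    have "card U \<le> card (T \<union> U)" by (rule card_mono[OF fin]) auto
    hence "small (r + 2) U" using that(1) by (auto simp: small_def)
    hence "v U \<beta> \<in> carrier_vec d" using that d by blast
    moreover have "scalar_prod (v T \<alpha>) (v U \<beta>)
        = measure_pmf.prob (\<mu> (T \<union> U)) {z. restrict z T = \<alpha> \<and> restrict z U = \<beta>}"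
      by (rule prod) (use that in \<open>auto simp: small_def\<close>)
    ultimately show ?thesis by (simp add: scalar_prod_def atLeast0LessThan)
  qed
  have S': "small (r + 2) S" using small_mono[OF S] by simp
  define q where "q = pmf (\<mu> S) x"
  have q: "q > 0" using x by (simp add: q_def pmf_positive)
  have xS: "x \<in> S \<rightarrow>\<^sub>E {..<k}" by (rule support[OF S' x])
  have upd: "x(i := a) \<in> insert i S \<rightarrow>\<^sub>E {..<k}" if "a < k" for i a
    using xS that by (auto simp: PiE_iff extensional_def)
  have iff: "restrict z (insert i S) = x(i := a) \<longleftrightarrow> restrict z S = x \<and> z i = a"
    if "\<not> (i \<in> S \<and> x i \<noteq> a)" for z i a
  proof -
    have "x l = undefined" if "l \<notin> S" for l using xS that by (auto simp: PiE_iff extensional_def)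
    thus ?thesis using that by (auto simp: restrict_def fun_eq_iff)
  qed
  have ip2: "(\<Sum>s<d. cond_vec S x i a s * cond_vec S x j b s) = q * cond2 S x i a j b"
    if "i < n" "a < k" "j < n" "b < k" for i a j b
  proof (cases "(i \<in> S \<and> x i \<noteq> a) \<or> (j \<in> S \<and> x j \<noteq> b)")
    \<comment> \<open>A contradictory assignment has probability 0, in agreement with the zero
      vector in \<open>cond_vec\<close>.\<close>
    case True
    hence empty: "{z. restrict z S = x \<and> z i = a \<and> z j = b} = {}" by auto
    have "cond2 S x i a j b = 0" unfolding cond2_def empty by simp
    thus ?thesis using True by (auto simp: cond_vec_def)
  next
    case False
    have un: "insert i S \<union> insert j S = insert i (insert j S)" by auto
    have T: "small (r + 2) (insert i S \<union> insert j S)"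
      unfolding un using small_insert[OF small_insert[OF S that(3)] that(1)] by simp
    have i': "\<not> (i \<in> S \<and> x i \<noteq> a)" and j': "\<not> (j \<in> S \<and> x j \<noteq> b)" using False by auto
    have "(\<Sum>s<d. cond_vec S x i a s * cond_vec S x j b s)
        = (\<Sum>s<d. vec_index (v (insert i S) (x(i := a))) s * vec_index (v (insert j S) (x(j := b))) s)"
      by (simp only: cond_vec_def if_not_P[OF i'] if_not_P[OF j'])
    also have "\<dots> = measure_pmf.prob (\<mu> (insert i (insert j S)))
        {z. restrict z (insert i S) = x(i := a) \<and> restrict z (insert j S) = x(j := b)}"
      using ip[OF T upd upd] that by (simp only: un)
    also have "{z. restrict z (insert i S) = x(i := a) \<and> restrict z (insert j S) = x(j := b)}
        = {z. restrict z S = x \<and> z i = a \<and> z j = b}"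
      using iff[OF i'] iff[OF j'] by auto
    finally show ?thesis using q by (simp add: cond2_def q_def)
  qed
  have ip1: "(\<Sum>s<d. cond_vec S x i a s * vec_index (v S x) s) = q * cond1 S x i a" if "i < n" "a < k" for i a
  proof (cases "i \<in> S \<and> x i \<noteq> a")
    case True
    hence empty: "{z. restrict z S = x \<and> z i = a} = {}" by auto
    have "cond1 S x i a = 0" unfolding cond1_def empty by simp
    thus ?thesis using True by (simp add: cond_vec_def)
  next
    case False
    have un: "insert i S \<union> S = insert i S" by auto
    have T: "small (r + 2) (insert i S \<union> S)"
      unfolding un using small_mono[OF small_insert[OF S that(1)], of "r + 2"] by simp
    have "(\<Sum>s<d. cond_vec S x i a s * vec_index (v S x) s) = (\<Sum>s<d. vec_index (v (insert i S) (x(i := a))) s * vec_index (v S x) s)"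
      by (simp only: cond_vec_def if_not_P[OF False])
    also have "\<dots> = measure_pmf.prob (\<mu> (insert i S))
        {z. restrict z (insert i S) = x(i := a) \<and> restrict z S = x}"
      using ip[OF T upd xS] that by (simp only: un)
    also have "{z. restrict z (insert i S) = x(i := a) \<and> restrict z S = x} = {z. restrict z S = x \<and> z i = a}"
      using iff[OF False] by auto
    finally show ?thesis using q by (simp add: cond1_def q_def)
  qed
  have ip0: "(\<Sum>s<d. vec_index (v S x) s * vec_index (v S x) s) = q"
    using ip[of S S x x] S' xS pmf_marginal[OF S' order_refl, of x] by (simp add: q_def)
  \<comment> \<open>\<open>v S x\<close> has squared length \<open>q\<close> and inner product
    \<open>q * cond1 S x i a\<close> with the conditioned vector. So this is the component
    orthogonal to \<open>v S x\<close>, and dividing by \<open>sqrt q\<close> turns probabilities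
    into conditional ones.\<close>
  define u where "u i a s = (cond_vec S x i a s - cond1 S x i a * vec_index (v S x) s) / sqrt q" for i a s
  have "cov (cond1 S x) (cond2 S x) i a j b = (\<Sum>s<d. u i a s * u j b s)"
    if "i < n" "a < k" "j < n" "b < k" for i a j b
  proof -
    have "u i a s * u j b s
        = (cond_vec S x i a s - cond1 S x i a * vec_index (v S x) s) * (cond_vec S x j b s - cond1 S x j b * vec_index (v S x) s) / q" for s
      using q by (simp add: u_def)
    hence "u i a s * u j b s = (cond_vec S x i a s * cond_vec S x j b s
        - cond1 S x j b * (cond_vec S x i a s * vec_index (v S x) s) - cond1 S x i a * (cond_vec S x j b s * vec_index (v S x) s)
        + cond1 S x i a * cond1 S x j b * (vec_index (v S x) s * vec_index (v S x) s)) / q" for s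
      by (simp add: algebra_simps)
    hence "(\<Sum>s<d. u i a s * u j b s) = (q * cond2 S x i a j b - cond1 S x j b * (q * cond1 S x i a)
        - cond1 S x i a * (q * cond1 S x j b) + cond1 S x i a * cond1 S x j b * q) / q"
      using that
      by (simp only: sum_divide_distrib[symmetric] sum.distrib sum_subtractf sum_distrib_left[symmetric] ip0 ip1 ip2)
    also have "\<dots> = cov (cond1 S x) (cond2 S x) i a j b"
      using q by (simp add: cov_def field_simps)
    finally show ?thesis ..
  qed
  thus ?thesis by blast
qed

end

section \<open>Random seeds\<close>

context local_distributions
begin

definition seed_average :: "nat \<Rightarrow> (nat set \<Rightarrow> real) \<Rightarrow> real" where
  "seed_average m g = (\<Sum>s | set s \<subseteq> {..<n} \<and> length s = m. g (set s)) / real (n ^ m)"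

text \<open>As repetitions are allowed, a uniform tuple of length m + 1 is a uniform tuple of length
  m with an independent uniform vertex added.\<close>

lemma seed_average_Suc:
  "seed_average (Suc m) g = seed_average m (\<lambda>S. \<Sum>j<n. g (insert j S)) / n"
proof -
  let ?L = "{s. set s \<subseteq> {..<n} \<and> length s = m}"
  have "(\<Sum>s | set s \<subseteq> {..<n} \<and> length s = Suc m. g (set s))
      = (\<Sum>(s, j)\<in>?L \<times> {..<n}. g (insert j (set s)))"
    unfolding lists_length_Suc_eq
    by (subst sum.reindex) (auto simp: inj_on_def split_def)
  also have "\<dots> = (\<Sum>s\<in>?L. \<Sum>j<n. g (insert j (set s)))"
    by (rule sum.cartesian_product[symmetric])
  finally show ?thesis by (simp add: seed_average_def mult.commute)
qed

lemma small_set: "set s \<subseteq> {..<n} \<Longrightarrow> length s = m \<Longrightarrow> small m (set s)"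
  by (auto simp: small_def card_length)

lemma seed_average_mono:
  assumes "\<And>S. small m S \<Longrightarrow> g S \<le> h S"
  shows "seed_average m g \<le> seed_average m h"
  unfolding seed_average_def
  by (intro divide_right_mono sum_mono) (use assms small_set in auto)

lemma seed_average_const: "0 < n \<Longrightarrow> seed_average m (\<lambda>_. c) = c"
  by (simp add: seed_average_def card_lists_length_eq)

lemma seed_average_linear:
  "seed_average m (\<lambda>S. a * g S + b * h S) = a * seed_average m g + b * seed_average m h"
  by (simp add: seed_average_def sum.distrib sum_distrib_left add_divide_distrib)

text \<open>The term for \<open>m\<close> is n times the increase of the average energy from m to m
  + 1 seeds. The sum telescopes, and energies lie between 0 and n.\<close>

lemma sum_seed_average_variance_drop:
  assumes n: "0 < n"
  shows "(\<Sum>m=1..r. seed_average m (\<lambda>S. measure_pmf.expectation (\<mu> S)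
      (\<lambda>x. \<Sum>i<n. \<Sum>j<n. variance_drop k (cond1 S x) (cond2 S x) i j))) \<le> (real n)\<^sup>2"
proof -
  let ?E = "\<lambda>m. seed_average m energy"
  have "seed_average m (\<lambda>S. measure_pmf.expectation (\<mu> S)
      (\<lambda>x. \<Sum>i<n. \<Sum>j<n. variance_drop k (cond1 S x) (cond2 S x) i j)) = n * (?E (Suc m) - ?E m)"
    if "m \<in> {1..r}" for m
  proof -
    have "seed_average m (\<lambda>S. measure_pmf.expectation (\<mu> S)
        (\<lambda>x. \<Sum>i<n. \<Sum>j<n. variance_drop k (cond1 S x) (cond2 S x) i j))
        = seed_average m (\<lambda>S. 1 * (\<Sum>j<n. energy (insert j S)) + (- real n) * energy S)"
      unfolding seed_average_def
      by (intro arg_cong2[of _ _ _ _ "(/)"] sum.cong refl)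
        (use expectation_variance_drop[OF small_mono[OF small_set]] that in auto)
    also have "\<dots> = n * (?E (Suc m) - ?E m)"
      unfolding seed_average_linear seed_average_Suc using n by (simp add: field_simps)
    finally show ?thesis .
  qed
  hence "(\<Sum>m=1..r. seed_average m (\<lambda>S. measure_pmf.expectation (\<mu> S)
      (\<lambda>x. \<Sum>i<n. \<Sum>j<n. variance_drop k (cond1 S x) (cond2 S x) i j)))
      = n * (\<Sum>m=1..r. ?E (Suc m) - ?E m)"
    by (simp add: sum_distrib_left)
  also have "(\<Sum>m=1..r. ?E (Suc m) - ?E m) = ?E (Suc r) - ?E 1"
    by (rule sum_Suc_diff) simp
  also have "\<dots> \<le> real n - 0"
  proof (rule diff_mono)
    \<comment> \<open>Seed sets of size r + 1 occur here; \<open>energy_le\<close> admits them,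
      because energy involves only one further vertex.\<close>
    have "?E (Suc r) \<le> seed_average (Suc r) (\<lambda>_. real n)"
      by (rule seed_average_mono) (simp add: energy_le)
    thus "?E (Suc r) \<le> n" by (simp add: seed_average_const n)
    show "0 \<le> ?E 1"
      by (auto simp: seed_average_def intro!: sum_nonneg divide_nonneg_nonneg energy_nonneg)
  qed
  finally show ?thesis by (simp add: power2_eq_square mult_left_mono)
qed

end

section \<open>The constraint graph\<close>

lemma csp_value_bounds: "0 \<le> csp_value I x" "csp_value I x \<le> 1"
  by (auto simp: csp_value_def)

lemma prob_eq_sum:
  assumes "finite (set_pmf p)"
  shows "measure_pmf.prob p {c. Q c} = (\<Sum>c\<in>set_pmf p. pmf p c * (if Q c then 1 else 0))"
proof -
  have "measure_pmf.prob p {c. Q c} = measure_pmf.prob p {c \<in> set_pmf p. Q c}"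
    by (rule prob_cong_support) simp
  also have "\<dots> = (\<Sum>c\<in>{c \<in> set_pmf p. Q c}. pmf p c)"
    by (rule measure_measure_pmf_finite) (use assms in simp)
  also have "\<dots> = (\<Sum>c\<in>set_pmf p. if Q c then pmf p c else 0)"
    by (rule sum.inter_filter[OF assms])
  also have "\<dots> = (\<Sum>c\<in>set_pmf p. pmf p c * (if Q c then 1 else 0))"
    by (rule sum.cong) auto
  finally show ?thesis .
qed

text \<open>Each constraint contributes once per orientation. For a loop the two orientations
  coincide, which reproduces the factor 2 in \<open>adjacency\<close>.\<close>

lemma adjacency_eq_sum:
  fixes I :: "constraint pmf"
  assumes "finite (set_pmf I)"
  shows "adjacency I i j = (\<Sum>c\<in>set_pmf I. pmf I c *
    ((if fst c = i then 1 else 0) * (if fst (snd c) = j then 1 else 0)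
      + (if fst c = j then 1 else 0) * (if fst (snd c) = i then 1 else 0)))"
proof -
  have "{(a, b, P). {a, b} = {i, j}} = {c :: constraint. {fst c, fst (snd c)} = {i, j}}"
    by (simp add: case_prod_unfold)
  hence w: "edge_weight I i j
      = (\<Sum>c\<in>set_pmf I. pmf I c * (if {fst c, fst (snd c)} = {i, j} then 1 else 0))"
    unfolding edge_weight_def by (simp only: prob_eq_sum[OF assms])
  have "adjacency I i j = (if i = j then 2 else 1) * edge_weight I i j"
    by (simp add: adjacency_def)
  also have "\<dots> = (\<Sum>c\<in>set_pmf I. pmf I c *
      ((if i = j then 2 else 1) * (if {fst c, fst (snd c)} = {i, j} then 1 else 0)))"
    unfolding w sum_distrib_left by (simp only: mult.left_commute)
  also have "\<dots> = (\<Sum>c\<in>set_pmf I. pmf I c *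
    ((if fst c = i then 1 else 0) * (if fst (snd c) = j then 1 else 0)
      + (if fst c = j then 1 else 0) * (if fst (snd c) = i then 1 else 0)))"
    by (intro sum.cong refl arg_cong2[of _ _ _ _ "(*)"]) (auto simp: doubleton_eq_iff)
  finally show ?thesis .
qed

lemma sum_adjacency:
  fixes I :: "constraint pmf" and f :: "nat \<Rightarrow> nat \<Rightarrow> real"
  assumes I: "max_2csp n k I" and sym: "\<And>i j. i < n \<Longrightarrow> j < n \<Longrightarrow> f i j = f j i"
    and fin: "finite (set_pmf I)"
  shows "(\<Sum>i<n. \<Sum>j<n. adjacency I i j * f i j) = 2 * (\<Sum>c\<in>set_pmf I. pmf I c * f (fst c) (fst (snd c)))"
proof -
  let ?d = "\<lambda>a i :: nat. if a = i then 1 else 0 :: real"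
  let ?g = "\<lambda>c i j. (?d (fst c) i * ?d (fst (snd c)) j + ?d (fst c) j * ?d (fst (snd c)) i) * f i j"
  have "(\<Sum>i<n. \<Sum>j<n. adjacency I i j * f i j) = (\<Sum>i<n. \<Sum>j<n. \<Sum>c\<in>set_pmf I. pmf I c * ?g c i j)"
    by (simp only: adjacency_eq_sum[OF fin] sum_distrib_right mult.assoc)
  also have "\<dots> = (\<Sum>i<n. \<Sum>c\<in>set_pmf I. \<Sum>j<n. pmf I c * ?g c i j)"
    by (rule sum.cong[OF refl], rule sum.swap)
  also have "\<dots> = (\<Sum>c\<in>set_pmf I. \<Sum>i<n. \<Sum>j<n. pmf I c * ?g c i j)"
    by (rule sum.swap)
  also have "\<dots> = (\<Sum>c\<in>set_pmf I. 2 * (pmf I c * f (fst c) (fst (snd c))))"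
  proof (rule sum.cong[OF refl])
    fix c assume c: "c \<in> set_pmf I"
    define a b where "a = fst c" and "b = fst (snd c)"
    have ab: "a < n" "b < n" using I c by (auto simp: max_2csp_def a_def b_def)
    have "(\<Sum>i<n. \<Sum>j<n. ?g c i j)
        = (\<Sum>i<n. \<Sum>j<n. (if b = j then ?d a i * f i j else 0) + (if a = j then ?d b i * f i j else 0))"
      by (intro sum.cong refl) (simp add: a_def b_def)
    also have "\<dots> = (\<Sum>i<n. ?d a i * f i b + ?d b i * f i a)"
      using ab by (intro sum.cong refl) (simp add: sum.distrib)
    also have "\<dots> = (\<Sum>i<n. (if a = i then f i b else 0) + (if b = i then f i a else 0))"
      by (intro sum.cong refl) simp
    also have "\<dots> = 2 * f a b" using ab sym[OF ab] by (simp add: sum.distrib)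
    finally have "(\<Sum>i<n. \<Sum>j<n. ?g c i j) = 2 * f a b" .
    thus "(\<Sum>i<n. \<Sum>j<n. pmf I c * ?g c i j) = 2 * (pmf I c * f (fst c) (fst (snd c)))"
      by (simp only: sum_distrib_left[symmetric] a_def b_def mult.left_commute)
  qed
  finally show ?thesis by (simp only: sum_distrib_left)
qed

lemma adjacency_sym: "adjacency I i j = adjacency I j i"
  by (simp add: adjacency_def edge_weight_def insert_commute)

text \<open>The degrees sum to twice the total mass 1, by \<open>sum_adjacency\<close> for the
  constant 1.\<close>

lemma regular_degree:
  fixes I :: "constraint pmf"
  assumes I: "max_2csp n k I" and reg: "regular_constraint_graph n I"
    and fin: "finite (set_pmf I)" and i: "i < n"
  shows "weighted_degree n I i = 2 / n"
proof -
  obtain d where d: "\<And>i. i < n \<Longrightarrow> weighted_degree n I i = d"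
    using reg by (auto simp: regular_constraint_graph_def)
  have "n * d = (\<Sum>i<n. weighted_degree n I i)" by (simp add: d)
  also have "\<dots> = (\<Sum>i<n. \<Sum>j<n. adjacency I i j * 1)" by (simp add: weighted_degree_def)
  also have "\<dots> = 2 * (\<Sum>c\<in>set_pmf I. pmf I c * 1)"
    by (rule sum_adjacency[OF I _ fin]) simp
  also have "\<dots> = 2" using sum_pmf_eq_1[OF fin order_refl] by simp
  finally have "n * d = 2" .
  thus ?thesis using d[OF i] i by (simp add: field_simps)
qed

lemma finite_set_max_2csp: "max_2csp n k I \<Longrightarrow> finite (set_pmf I)"
  unfolding max_2csp_def by (rule finite_subset) auto

lemma max_2csp_pos:
  assumes "max_2csp n k I"
  shows "0 < n"
  using assms set_pmf_not_empty[of I] by (auto simp: max_2csp_def)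

lemma csp_value_eq_sum:
  assumes "finite (set_pmf I)"
  shows "csp_value I y
    = (\<Sum>c\<in>set_pmf I. pmf I c * (if (y (fst c), y (fst (snd c))) \<in> snd (snd c) then 1 else 0))"
  unfolding csp_value_def prob_eq_sum[OF assms, symmetric] by (simp add: case_prod_unfold)

lemma solution_value_eq_sum:
  assumes "finite (set_pmf I)"
  shows "solution_value I \<mu> = (\<Sum>c\<in>set_pmf I. pmf I c *
    measure_pmf.prob (\<mu> {fst c, fst (snd c)}) {z. (z (fst c), z (fst (snd c))) \<in> snd (snd c)})"
  unfolding solution_value_def
  by (subst integral_measure_pmf[OF assms]) (auto simp: case_prod_unfold)

lemma solution_value_le_1:
  assumes "finite (set_pmf I)"
  shows "solution_value I \<mu> \<le> 1"
proof -
  have "solution_value I \<mu> \<le> (\<Sum>c\<in>set_pmf I. pmf I c * 1)"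
    unfolding solution_value_eq_sum[OF assms] by (intro sum_mono mult_left_mono) auto
  also have "\<dots> = 1" using sum_pmf_eq_1[OF assms order_refl] by simp
  finally show ?thesis .
qed

locale regular_csp =
  fixes n k :: nat and I :: "constraint pmf"
  assumes csp: "max_2csp n k I" and regular: "regular_constraint_graph n I"
begin

abbreviation entry :: "nat \<Rightarrow> nat \<Rightarrow> real" where
  "entry i j \<equiv> constraint_graph n I $$ (i, j)"

lemmas finite_I = finite_set_max_2csp[OF csp] and n_pos = max_2csp_pos[OF csp]

lemma degree: "i < n \<Longrightarrow> weighted_degree n I i = 2 / n"
  by (rule regular_degree[OF csp regular finite_I])

lemma entry_eq: "i < n \<Longrightarrow> j < n \<Longrightarrow> entry i j = n / 2 * adjacency I i j"
  by (simp add: constraint_graph_def degree)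

lemma graph_carrier: "constraint_graph n I \<in> carrier_mat n n"
  by (simp add: constraint_graph_def)

lemma graph_symmetric: "transpose_mat (constraint_graph n I) = constraint_graph n I"
  by (rule eq_matI) (auto simp: constraint_graph_def degree adjacency_sym)

lemma entry_nonneg: "i < n \<Longrightarrow> j < n \<Longrightarrow> 0 \<le> entry i j"
  by (simp add: entry_eq adjacency_def edge_weight_def)

lemma entry_row:
  assumes "i < n"
  shows "(\<Sum>j<n. entry i j) = 1"
proof -
  have "(\<Sum>j<n. entry i j) = n / 2 * weighted_degree n I i"
    unfolding weighted_degree_def sum_distrib_left
    by (intro sum.cong refl) (use assms in \<open>simp add: entry_eq\<close>)
  thus ?thesis using n_pos degree[OF assms] by simp
qed

lemma entry_col:
  assumes "j < n"
  shows "(\<Sum>i<n. entry i j) = 1"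
proof -
  have "(\<Sum>i<n. entry i j) = (\<Sum>i<n. entry j i)"
    by (intro sum.cong refl) (use assms in \<open>simp add: entry_eq adjacency_sym\<close>)
  thus ?thesis using entry_row[OF assms] by simp
qed

text \<open>Carries an average over constraints, in which the rounding loss is measured, to a sum
  against the normalized adjacency matrix, to which the spectral bound applies.\<close>

lemma sum_entry:
  assumes "\<And>i j. i < n \<Longrightarrow> j < n \<Longrightarrow> f i j = f j i"
  shows "(\<Sum>i<n. \<Sum>j<n. entry i j * f i j) = n * (\<Sum>c\<in>set_pmf I. pmf I c * f (fst c) (fst (snd c)))"
proof -
  have "(\<Sum>i<n. \<Sum>j<n. entry i j * f i j) = n / 2 * (\<Sum>i<n. \<Sum>j<n. adjacency I i j * f i j)"
    unfolding sum_distrib_left by (intro sum.cong refl) (simp add: entry_eq)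
  thus ?thesis using sum_adjacency[OF csp assms finite_I] by simp
qed

text \<open>The all-ones vector is an eigenvector with eigenvalue 1.\<close>

lemma threshold_rank_pos:
  assumes "0 \<le> \<tau>" "\<tau> < 1"
  shows "0 < threshold_rank \<tau> (constraint_graph n I)"
proof (rule ccontr)
  assume "\<not> 0 < threshold_rank \<tau> (constraint_graph n I)"
  hence rank: "threshold_rank \<tau> (constraint_graph n I) = 0" by simp
  obtain l f where dec: "spectral_decomposition n entry l f"
    and m: "\<forall>\<tau>. threshold_rank \<tau> (constraint_graph n I) = card {s. s < n \<and> \<tau> < l s}"
    using symmetric_spectral_decomposition[OF graph_carrier graph_symmetric] .
  have le1: "l s \<le> 1" if "s < n" for s
    by (rule stochastic_eigenvalue_le_1[of n entry l f])
      (use entry_nonneg entry_row entry_col dec that in auto)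
  have empty: "{s. s < n \<and> \<tau> < l s} = {}" using m rank by simp
  \<comment> \<open>At the all-ones vector the form equals n; without eigenvalues above \<tau> it
    would be at most \<open>\<tau> * n\<close>.\<close>
  have "(\<Sum>i<n. \<Sum>j<n. entry i j * (1 * 1)) \<le> \<tau> * (\<Sum>i<n. 1 * 1)
      + (\<Sum>i<n. \<Sum>j<n. (\<Sum>s | s < n \<and> \<tau> < l s. f s i * f s j) * (1 * 1))"
    by (rule quadratic_form_le_threshold[OF dec le1 assms(1)])
  hence "real n \<le> \<tau> * n" unfolding empty by (simp add: entry_row)
  thus False using assms(2) n_pos by simp
qed

end

section \<open>Propagation sampling\<close>

locale rounding = regular_csp n k I + lasserre_vectors n k r \<mu> v
  for n k r :: nat and I :: "constraint pmf" and \<mu> v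
begin

abbreviation total_drop :: "nat set \<Rightarrow> (nat \<Rightarrow> nat) \<Rightarrow> real" where
  "total_drop S x \<equiv> \<Sum>i<n. \<Sum>j<n. variance_drop k (cond1 S x) (cond2 S x) i j"

text \<open>The correlation bound for the laws conditioned on \<open>X\<^sub>S = x\<close>, divided
  by n: the rounding loss averaged over the constraints.\<close>

lemma cond_pair_dist_le:
  fixes \<tau> K \<eta> :: real
  assumes S: "small r S" and x: "x \<in> set_pmf (\<mu> S)"
    and \<tau>: "0 \<le> \<tau>" and K: "0 < K" and \<eta>: "0 < \<eta>"
    and m: "m = threshold_rank \<tau> (constraint_graph n I)"
  shows "(\<Sum>c\<in>set_pmf I. pmf I c * pair_dist k (cond1 S x) (cond2 S x) (fst c) (fst (snd c)))
    \<le> 4 / K + \<eta> + k / (4 * \<eta>) * \<tau> + k / (4 * \<eta>) * (K * m / (real n)\<^sup>2) * total_drop S x"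
    (is "?L \<le> ?R")
proof -
  interpret pairwise_distributions n k "cond1 S x" "cond2 S x" by (rule pairwise_cond[OF S x])
  obtain l f where dec: "spectral_decomposition n entry l f"
    and m': "\<forall>\<tau>. threshold_rank \<tau> (constraint_graph n I) = card {s. s < n \<and> \<tau> < l s}"
    using symmetric_spectral_decomposition[OF graph_carrier graph_symmetric] .
  obtain d :: nat and u where gram: "\<forall>i a j b. i < n \<longrightarrow> a < k \<longrightarrow> j < n \<longrightarrow> b < k \<longrightarrow>
      cov (cond1 S x) (cond2 S x) i a j b = (\<Sum>s<d. u i a s * u j b s)"
    using cond_covariance_gram[OF S x] by blast
  have sym: "pair_dist k (cond1 S x) (cond2 S x) i j = pair_dist k (cond1 S x) (cond2 S x) j i"
    if "i < n" "j < n" for i j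
  proof -
    have "pair_dist k (cond1 S x) (cond2 S x) i j
        = (\<Sum>a<k. \<Sum>b<k. \<bar>cov (cond1 S x) (cond2 S x) j b i a\<bar>)"
      unfolding pair_dist_def by (intro sum.cong refl) (use cov_sym that in auto)
    also have "\<dots> = pair_dist k (cond1 S x) (cond2 S x) j i"
      unfolding pair_dist_def by (rule sum.swap)
    finally show ?thesis .
  qed
  have "(\<Sum>i<n. \<Sum>j<n. entry i j * pair_dist k (cond1 S x) (cond2 S x) i j)
      \<le> 4 * n / K + \<eta> * n + k / (4 * \<eta>) * (\<tau> * n + K * m / n * total_drop S x)"
    by (rule pair_dist_le_global_correlation[where u = u and l = l and f = f and m = m,
          OF _ entry_nonneg entry_row entry_col dec _ \<tau> n_pos K \<eta>])
      (use gram m m' in auto)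
  hence "n * ?L \<le> 4 * n / K + \<eta> * n + k / (4 * \<eta>) * (\<tau> * n + K * m / n * total_drop S x)"
    by (simp only: sum_entry[of "pair_dist k (cond1 S x) (cond2 S x)", OF sym])
  also have "\<dots> = n * ?R" using n_pos \<eta> K by (simp add: field_simps power2_eq_square)
  finally show ?thesis using n_pos by simp
qed

lemma expectation_propagate_ge:
  assumes S: "small r S" and x: "x \<in> set_pmf (\<mu> S)"
  shows "measure_pmf.expectation (propagate n \<mu> S x) (csp_value I)
    \<ge> (\<Sum>c\<in>set_pmf I. pmf I c *
        (\<Sum>(a, b)\<in>snd (snd c) \<inter> ({..<k} \<times> {..<k}). cond2 S x (fst c) a (fst (snd c)) b))
      - (\<Sum>c\<in>set_pmf I. pmf I c * pair_dist k (cond1 S x) (cond2 S x) (fst c) (fst (snd c)))"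
proof -
  let ?sat = "\<lambda>c y. (y (fst c), y (fst (snd c))) \<in> snd (snd c)"
  have int: "integrable (measure_pmf (propagate n \<mu> S x)) g" for g :: "_ \<Rightarrow> real"
    using small_mono[OF S, of "r + 1"] by (intro integrable_measure_pmf_finite finite_set_propagate[OF _ x]) simp
  have prob: "measure_pmf.expectation p (\<lambda>y. if Q y then 1 else 0 :: real) = measure_pmf.prob p {y. Q y}"
    for p :: "(nat \<Rightarrow> nat) pmf" and Q
  proof -
    have "(\<lambda>y. if Q y then 1 else 0 :: real) = indicator {y. Q y}" by (auto simp: indicator_def)
    thus ?thesis by simp
  qed
  have csp_value: "csp_value I = (\<lambda>y. \<Sum>c\<in>set_pmf I. pmf I c * (if ?sat c y then 1 else 0))"
    by (rule ext, rule csp_value_eq_sum[OF finite_I])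
  have "measure_pmf.expectation (propagate n \<mu> S x) (csp_value I)
      = measure_pmf.expectation (propagate n \<mu> S x)
          (\<lambda>y. \<Sum>c\<in>set_pmf I. pmf I c * (if ?sat c y then 1 else 0))"
    by (simp only: csp_value)
  also have "\<dots> = (\<Sum>c\<in>set_pmf I. measure_pmf.expectation (propagate n \<mu> S x)
          (\<lambda>y. pmf I c * (if ?sat c y then 1 else 0)))"
    by (rule Bochner_Integration.integral_sum[OF int])
  also have "\<dots> = (\<Sum>c\<in>set_pmf I. pmf I c * measure_pmf.prob (propagate n \<mu> S x) {y. ?sat c y})"
    by (simp only: integral_mult_right_zero prob)
  also have "\<dots> \<ge> (\<Sum>c\<in>set_pmf I. pmf I c *
        ((\<Sum>(a, b)\<in>snd (snd c) \<inter> ({..<k} \<times> {..<k}). cond2 S x (fst c) a (fst (snd c)) b)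
          - pair_dist k (cond1 S x) (cond2 S x) (fst c) (fst (snd c))))"
    by (intro sum_mono mult_left_mono propagate_ge[OF S x])
      (use csp in \<open>auto simp: max_2csp_def\<close>)
  finally show ?thesis by (simp only: right_diff_distrib sum_subtractf)
qed

text \<open>On averaging over \<open>x\<close>, the conditioned values return the value of the
  solution by \<open>expectation_cond2\<close>. The factor 1 and the negated coefficient give the
  shape of \<open>seed_average_linear\<close>.\<close>

lemma expectation_round_ge:
  fixes \<tau> K \<eta> :: real
  assumes S: "small r S"
    and \<tau>: "0 \<le> \<tau>" and K: "0 < K" and \<eta>: "0 < \<eta>"
    and m: "m = threshold_rank \<tau> (constraint_graph n I)"
  shows "measure_pmf.expectation (\<mu> S \<bind> propagate n \<mu> S) (csp_value I)
    \<ge> (solution_value I \<mu> - (4 / K + \<eta> + k / (4 * \<eta>) * \<tau>)) * 1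
      + (- (k / (4 * \<eta>) * (K * m / (real n)\<^sup>2))) * measure_pmf.expectation (\<mu> S) (total_drop S)"
proof -
  let ?V = "\<lambda>x. \<Sum>c\<in>set_pmf I. pmf I c *
        (\<Sum>(a, b)\<in>snd (snd c) \<inter> ({..<k} \<times> {..<k}). cond2 S x (fst c) a (fst (snd c)) b)"
  let ?e = "4 / K + \<eta> + k / (4 * \<eta>) * \<tau>" and ?c = "k / (4 * \<eta>) * (K * m / (real n)\<^sup>2)"
  have S': "small (r + 2) S" using small_mono[OF S] by simp
  have fin: "finite (set_pmf (\<mu> S))" by (rule finite_support[OF S'])
  have int: "integrable (measure_pmf (\<mu> S)) g" for g :: "_ \<Rightarrow> real"
    by (rule integrable_measure_pmf_finite[OF fin])
  have "measure_pmf.expectation (\<mu> S) ?V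
      = (\<Sum>c\<in>set_pmf I. measure_pmf.expectation (\<mu> S) (\<lambda>x. pmf I c *
        (\<Sum>(a, b)\<in>snd (snd c) \<inter> ({..<k} \<times> {..<k}). cond2 S x (fst c) a (fst (snd c)) b)))"
    by (rule Bochner_Integration.integral_sum[OF int])
  also have "\<dots> = solution_value I \<mu>"
    unfolding solution_value_eq_sum[OF finite_I] integral_mult_right_zero
    by (intro sum.cong refl arg_cong2[of _ _ _ _ "(*)"] expectation_cond2[OF S])
      (use csp in \<open>auto simp: max_2csp_def\<close>)
  finally have V: "measure_pmf.expectation (\<mu> S) ?V = solution_value I \<mu>" .
  have "solution_value I \<mu> - ?e - ?c * measure_pmf.expectation (\<mu> S) (total_drop S)
      = measure_pmf.expectation (\<mu> S) (\<lambda>x. ?V x - ?e - ?c * total_drop S x)"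
    by (simp only: Bochner_Integration.integral_diff[OF int int] V integral_mult_right_zero)
      simp
  also have "\<dots> \<le> measure_pmf.expectation (\<mu> S) (\<lambda>x. measure_pmf.expectation (propagate n \<mu> S x) (csp_value I))"
  proof (rule integral_mono_AE[OF int int], unfold AE_measure_pmf_iff, rule ballI)
    fix x assume x: "x \<in> set_pmf (\<mu> S)"
    show "?V x - ?e - ?c * total_drop S x \<le> measure_pmf.expectation (propagate n \<mu> S x) (csp_value I)"
      using expectation_propagate_ge[OF S x] cond_pair_dist_le[OF S x \<tau> K \<eta> m] by linarith
  qed
  also have "\<dots> = measure_pmf.expectation (\<mu> S \<bind> propagate n \<mu> S) (csp_value I)"
  proof -
    have "measure_pmf.expectation (\<mu> S \<bind> propagate n \<mu> S) (csp_value I)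
        = (\<Sum>x\<in>set_pmf (\<mu> S). pmf (\<mu> S) x *\<^sub>R measure_pmf.expectation (propagate n \<mu> S x) (csp_value I))"
      by (rule pmf_expectation_bind[OF fin])
        (use finite_set_propagate small_mono[OF S, of "r + 1"] in auto)
    also have "\<dots> = measure_pmf.expectation (\<mu> S) (\<lambda>x. measure_pmf.expectation (propagate n \<mu> S x) (csp_value I))"
      by (rule integral_measure_pmf[OF fin, symmetric])
    finally show ?thesis ..
  qed
  finally show ?thesis by simp
qed

section \<open>Averaging over the seeds and choosing the parameters\<close>

lemma expectation_propagation_sampling:
  assumes r: "0 < r"
  shows "measure_pmf.expectation (propagation_sampling n r \<mu>) (csp_value I)
    = (\<Sum>m=1..r. seed_average m (\<lambda>S. measure_pmf.expectation (\<mu> S \<bind> propagate n \<mu> S) (csp_value I))) / r"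
proof -
  let ?L = "\<lambda>m. {s. set s \<subseteq> {..<n} \<and> length s = m}"
  let ?G = "\<lambda>S. \<mu> S \<bind> propagate n \<mu> S"
  have L: "finite (?L m)" "?L m \<noteq> {}" "card (?L m) = n ^ m" for m
  proof -
    show "finite (?L m)" by (rule finite_lists_length_eq) simp
    have "set (replicate m 0) \<subseteq> {..<n}" using n_pos by auto
    thus "?L m \<noteq> {}" by (metis (mono_tags, lifting) empty_iff length_replicate mem_Collect_eq)
    show "card (?L m) = n ^ m" by (simp add: card_lists_length_eq)
  qed
  have fin_G: "finite (set_pmf (?G (set s)))" if "s \<in> ?L m" "m \<in> {1..r}" for s m
  proof -
    have S: "small r (set s)" using that small_mono[OF small_set] by auto
    show ?thesis
      using finite_support[OF small_mono[OF S]] finite_set_propagate[OF small_mono[OF S]] by simp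
  qed
  have inner: "measure_pmf.expectation (pmf_of_set (?L m) \<bind> (\<lambda>s. ?G (set s))) (csp_value I)
      = seed_average m (\<lambda>S. measure_pmf.expectation (?G S) (csp_value I))" if m: "m \<in> {1..r}" for m
  proof -
    have "measure_pmf.expectation (pmf_of_set (?L m) \<bind> (\<lambda>s. ?G (set s))) (csp_value I)
        = (\<Sum>s\<in>?L m. pmf (pmf_of_set (?L m)) s *\<^sub>R measure_pmf.expectation (?G (set s)) (csp_value I))"
      by (rule pmf_expectation_bind[OF L(1)]) (use fin_G m L set_pmf_of_set in auto)
    also have "\<dots> = (\<Sum>s\<in>?L m. measure_pmf.expectation (?G (set s)) (csp_value I) / real (n ^ m))"
      by (intro sum.cong refl) (simp add: pmf_of_set[OF L(2,1)] L(3) indicator_def)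
    finally show ?thesis by (simp add: seed_average_def sum_divide_distrib)
  qed
  have "measure_pmf.expectation (propagation_sampling n r \<mu>) (csp_value I)
      = (\<Sum>m\<in>{1..r}. pmf (pmf_of_set {1..r}) m *\<^sub>R
          measure_pmf.expectation (pmf_of_set (?L m) \<bind> (\<lambda>s. ?G (set s))) (csp_value I))"
    unfolding propagation_sampling_def
  proof (rule pmf_expectation_bind)
    fix m assume m: "m \<in> {1..r}"
    have "set_pmf (pmf_of_set (?L m)) = ?L m" by (rule set_pmf_of_set[OF L(2,1)])
    thus "finite (set_pmf (pmf_of_set (?L m) \<bind> (\<lambda>s. ?G (set s))))"
      using fin_G m L(1) by simp
  qed (use r in auto)
  also have "\<dots> = (\<Sum>m\<in>{1..r}. seed_average m (\<lambda>S. measure_pmf.expectation (?G S) (csp_value I)) / r)"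
    by (intro sum.cong refl) (use r in \<open>simp add: inner pmf_of_set\<close>)
  finally show ?thesis by (simp add: sum_divide_distrib)
qed

text \<open>Over all m the averaged drops sum to at most n^2. This cancels the n^2 in the
  coefficient, and the uniform choice of m leaves a factor 1 / r.\<close>

lemma propagation_sampling_ge:
  fixes \<tau> K \<eta> :: real
  assumes r: "0 < r" and \<tau>: "0 \<le> \<tau>" and K: "0 < K" and \<eta>: "0 < \<eta>"
    and m: "m = threshold_rank \<tau> (constraint_graph n I)"
  shows "measure_pmf.expectation (propagation_sampling n r \<mu>) (csp_value I)
    \<ge> solution_value I \<mu> - (4 / K + \<eta> + k / (4 * \<eta>) * \<tau>) - k / (4 * \<eta>) * (K * m / r)"
proof -
  let ?a = "solution_value I \<mu> - (4 / K + \<eta> + k / (4 * \<eta>) * \<tau>)"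
  let ?b = "k / (4 * \<eta>) * (K * m / (real n)\<^sup>2)"
  let ?D = "\<lambda>S. measure_pmf.expectation (\<mu> S) (total_drop S)"
  have "r * ?a - ?b * (real n)\<^sup>2 \<le> r * ?a - ?b * (\<Sum>j=1..r. seed_average j ?D)"
    using sum_seed_average_variance_drop[OF n_pos] K \<eta> by (intro diff_left_mono mult_left_mono) auto
  also have "\<dots> = (\<Sum>j=1..r. seed_average j (\<lambda>S. ?a * 1 + (- ?b) * ?D S))"
    unfolding seed_average_linear seed_average_const[OF n_pos] sum.distrib sum_distrib_left[symmetric]
    by simp
  also have "\<dots> \<le> (\<Sum>j=1..r. seed_average j (\<lambda>S. measure_pmf.expectation (\<mu> S \<bind> propagate n \<mu> S) (csp_value I)))"
    by (intro sum_mono seed_average_mono expectation_round_ge \<tau> K \<eta> m) (auto intro: small_mono)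
  finally have "(r * ?a - ?b * (real n)\<^sup>2) / r
      \<le> measure_pmf.expectation (propagation_sampling n r \<mu>) (csp_value I)"
    unfolding expectation_propagation_sampling[OF r] by (rule divide_right_mono) simp
  moreover have "(r * ?a - ?b * (real n)\<^sup>2) / r = ?a - k / (4 * \<eta>) * (K * m / r)"
    using r n_pos by (simp add: diff_divide_distrib)
  ultimately show ?thesis by simp
qed

text \<open>An instance by itself permits k = 0; the local law of the variable at vertex 0 needs a
  letter.\<close>

lemma alphabet_pos: "0 < k"
proof (rule ccontr)
  assume "\<not> 0 < k"
  moreover have "small (r + 2) {0}" using n_pos by (simp add: small_def)
  ultimately show False
    using support_less[of "{0}" _ 0] set_pmf_not_empty[of "\<mu> {0}"] by auto
qed

theorem propagation_sampling_loss:
  assumes \<epsilon>: "0 < \<epsilon>"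
    and rounds: "real r \<ge> 64 * real k * real (threshold_rank (1 / 4 * (\<epsilon> / real k)^2) (constraint_graph n I)) / \<epsilon>^4"
  shows "measure_pmf.expectation (propagation_sampling n r \<mu>) (csp_value I) \<ge> solution_value I \<mu> - \<epsilon>"
proof (cases "\<epsilon> < 1")
  \<comment> \<open>Values lie between 0 and 1, so a loss of at least 1 is no restriction.\<close>
  case False
  have "0 \<le> measure_pmf.expectation (propagation_sampling n r \<mu>) (csp_value I)"
    by (intro integral_nonneg_AE) (simp add: csp_value_bounds)
  thus ?thesis using solution_value_le_1[OF finite_I, of \<mu>] False by linarith
next
  case True
  define \<tau> where "\<tau> = 1 / 4 * (\<epsilon> / real k)^2"
  define m where "m = threshold_rank \<tau> (constraint_graph n I)"
  have k: "1 \<le> real k" using alphabet_pos by simp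
  have "\<epsilon> / k \<le> 1" using True k by (simp add: divide_le_eq)
  hence "(\<epsilon> / k)^2 \<le> 1" using \<epsilon> by (intro power_le_one) auto
  \<comment> \<open>\<tau> < 1 makes the threshold rank positive, so that the bound on the rounds
    forces r > 0 and there is an m to choose.\<close>
  hence \<tau>: "0 \<le> \<tau>" "\<tau> < 1" by (auto simp: \<tau>_def)
  have m: "0 < m" unfolding m_def by (rule threshold_rank_pos[OF \<tau>])
  have rounds': "64 * k * m / \<epsilon>^4 \<le> r" using rounds by (simp add: m_def \<tau>_def)
  have "0 < 64 * k * m / \<epsilon>^4" using alphabet_pos m \<epsilon> by simp
  hence r: "0 < r" using rounds' by (simp add: order.strict_trans2)
  have "64 * k * m \<le> r * \<epsilon>^4" using rounds' \<epsilon> by (simp add: divide_le_eq)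
  also have "\<dots> \<le> r * \<epsilon>^3" using True \<epsilon> by (intro mult_left_mono power_decreasing) auto
  finally have "64 * k * m \<le> r * \<epsilon>^3" .
  \<comment> \<open>The left side is 16 k m / (\<epsilon>^2 r), which explains the constant
    64.\<close>
  hence b: "k / (4 * (\<epsilon> / 4)) * (16 / \<epsilon> * m / r) \<le> \<epsilon> / 4"
    using r \<epsilon> by (simp add: field_simps power3_eq_cube)
  \<comment> \<open>The left side is \<epsilon> / (4 k).\<close>
  have c: "k / (4 * (\<epsilon> / 4)) * \<tau> \<le> \<epsilon> / 4"
    using k \<epsilon> by (simp add: \<tau>_def field_simps power2_eq_square)
  \<comment> \<open>With \<open>K = 16 / \<epsilon>\<close> and
    \<open>\<eta> = \<epsilon> / 4\<close> there are four losses, each at most \<epsilon> / 4: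
    discarded vertices, \<eta>, small eigenvalues, and global correlation.\<close>
  have "solution_value I \<mu> - (4 / (16 / \<epsilon>) + \<epsilon> / 4 + k / (4 * (\<epsilon> / 4)) * \<tau>) - k / (4 * (\<epsilon> / 4)) * (16 / \<epsilon> * m / r)
      \<le> measure_pmf.expectation (propagation_sampling n r \<mu>) (csp_value I)"
    by (rule propagation_sampling_ge[OF r \<tau>(1) _ _ m_def]) (use \<epsilon> in auto)
  thus ?thesis using b c \<epsilon> by simp
qed

end

text \<open>The given solution attains the supremum, so it is a maximum and no separate bound has to
  be shown.\<close>

lemma lasserre_value_eq:
  assumes "optimal_lasserre_solution n k r I \<mu> v"
  shows "lasserre_value n k r I = solution_value I \<mu>"
  unfolding lasserre_value_def
  by (rule cSup_eq_maximum) (use assms in \<open>auto simp: optimal_lasserre_solution_def\<close>)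

theorem theorem5p7:
  "\<exists>C c :: real. C > 0 \<and> c > 0 \<and>
     (\<forall>(n :: nat) (k :: nat) (r :: nat) (I :: constraint pmf) (\<epsilon> :: real) (\<sigma> :: real) \<mu> v.
        max_2csp n k I \<longrightarrow>
        regular_constraint_graph n I \<longrightarrow>
        \<epsilon> > 0 \<longrightarrow>
        real r \<ge> C * real k
          * real (threshold_rank (c * (\<epsilon> / real k)^2) (constraint_graph n I)) / \<epsilon>^4 \<longrightarrow>
        lasserre_value n k r I = \<sigma> \<longrightarrow>
        optimal_lasserre_solution n k r I \<mu> v \<longrightarrow>
        measure_pmf.expectation (propagation_sampling n r \<mu>) (csp_value I) \<ge> \<sigma> - \<epsilon>)"
proof (rule exI[of _ 64], rule exI[of _ "1 / 4"], intro conjI allI impI)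
  fix n k r I \<epsilon> \<sigma> \<mu> v
  assume csp: "max_2csp n k I" and reg: "regular_constraint_graph n I" and \<epsilon>: "\<epsilon> > (0 :: real)"
    and rounds: "real r \<ge> 64 * real k
      * real (threshold_rank (1 / 4 * (\<epsilon> / real k)^2) (constraint_graph n I)) / \<epsilon>^4"
    and val: "lasserre_value n k r I = \<sigma>" and opt: "optimal_lasserre_solution n k r I \<mu> v"
  interpret rounding n k r I \<mu> v
    by unfold_locales (use csp reg opt in \<open>auto simp: optimal_lasserre_solution_def\<close>)
  show "measure_pmf.expectation (propagation_sampling n r \<mu>) (csp_value I) \<ge> \<sigma> - \<epsilon>"
    using propagation_sampling_loss[OF \<epsilon> rounds] lasserre_value_eq[OF opt] val by simp
qed auto

end
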